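(* Let $p\ge1$ be an integer and let $(A_j)_{j\ge1}$ be a sequence of non-negative real random variables (with arbitrary dependencies) such that $A_j=0$ almost surely for all $j>p$ and $A_j>0$ almost surely for all $1\le j\le p$. Let $((A_{t,j})_{j\ge1})_{t\in\mathbb{Z}}$ be i.i.d. (over $t$) copies of $(A_j)_{j\ge1}$, and set $\tilde A_{t,j}=A_{-t,j}$. Let $\boldsymbol A$ be the random $p\times p$ companion matrix with first row $(A_1,\ldots,A_p)$, with entries $\boldsymbol A_{i+1,i}=1$ for $1\le i\le p-1$, and all other entries equal to $0$. Then $$\sum_{(\boldsymbol s,\boldsymbol t)\in\mathscr{C}}\mathbb{E}[\tilde A_{\boldsymbol s}\tilde A_{\boldsymbol t}]<1\quad\text{and}\quad\sum_{j=1}^\infty\mathbb{E}[A_j]<1$$ if and only if $$\rho(\mathbb{E}[\boldsymbol A\otimes\boldsymbol A])<1 .$$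
   Context: Sequences: let $\mathscr{T}$ be the set of finite integer sequences $\boldsymbol t=(t_0,\ldots,t_n)$ with $n\ge0$ and $0=t_0<t_1<\cdots<t_n$; write $n(\boldsymbol t)=n$ and $\tilde A_{\boldsymbol t}=\tilde A_{t_0,t_1-t_0}\cdots\tilde A_{t_{n-1},t_n-t_{n-1}}$, with $\tilde A_{(0)}=1$. Closed pairs: $\mathscr{C}$ is the set of pairs $(\boldsymbol s,\boldsymbol t)\in\mathscr{T}\times\mathscr{T}$ such that $n(\boldsymbol s)>0$, $n(\boldsymbol t)>0$, $s_{n(\boldsymbol s)}=t_{n(\boldsymbol t)}$, and $s_i\ne t_j$ for all $0<i<n(\boldsymbol s)$, $0<j<n(\boldsymbol t)$. $\otimes$ is the Kronecker (tensor) product of matrices, the expectation of a random matrix is taken entrywise, and $\rho(\boldsymbol M)$ is the spectral radius of a square matrix $\boldsymbol M$ (largest absolute value of its eigenvalues). Expectations and sums of non-negative quantities take values in $[0,\infty]$. If some entry of $\mathbb{E}[\boldsymbol A\otimes\boldsymbol A]$ is infinite, $\rho(\mathbb{E}[\boldsymbol A\otimes\boldsymbol A])$ is understood to be $+\infty$. *)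

theory Defs
  imports "HOL-Probability.Probability" "Jordan_Normal_Form.Spectral_Radius"
begin

text \<open>A sequence (A_j) with j \<ge> 1 is a function on \<^typ>\<open>nat\<close> whose value at 0 is never used.\<close>

definition seq_space :: "(nat \<Rightarrow> real) measure" where
  "seq_space = PiM {1..} (\<lambda>_. borel)"

definition seq_rv :: "(nat \<Rightarrow> 'a \<Rightarrow> real) \<Rightarrow> 'a \<Rightarrow> (nat \<Rightarrow> real)" where
  "seq_rv A \<omega> = (\<lambda>j\<in>{1..}. A j \<omega>)"

text \<open>The sequences are independent over t, with no condition on the dependence within a sequence;
  the copies may live on another probability space. Measurability of the copies is part of
  \<open>indep_vars\<close>.\<close>

definition iid_copies ::
  "'a measure \<Rightarrow> (nat \<Rightarrow> 'a \<Rightarrow> real) \<Rightarrow> 'b measure \<Rightarrow> (int \<Rightarrow> nat \<Rightarrow> 'b \<Rightarrow> real) \<Rightarrow> bool" where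
  "iid_copies M A N X \<longleftrightarrow>
     prob_space.indep_vars N (\<lambda>_. seq_space) (\<lambda>t. seq_rv (X t)) UNIV \<and>
     (\<forall>t. distr N seq_space (seq_rv (X t)) = distr M seq_space (seq_rv A))"

definition Atilde :: "(int \<Rightarrow> nat \<Rightarrow> 'b \<Rightarrow> real) \<Rightarrow> int \<Rightarrow> nat \<Rightarrow> 'b \<Rightarrow> real" where
  "Atilde X t j \<omega> = X (- t) j \<omega>"

text \<open>The sequence (t_0, ..., t_n) is the list of its n + 1 terms.\<close>

definition seqs :: "int list set" where
  "seqs = {t. t \<noteq> [] \<and> t ! 0 = 0 \<and> sorted_wrt (<) t}"

definition nsteps :: "int list \<Rightarrow> nat" where
  "nsteps t = length t - 1"

definition seq_prod :: "(int \<Rightarrow> nat \<Rightarrow> 'b \<Rightarrow> real) \<Rightarrow> int list \<Rightarrow> 'b \<Rightarrow> real" where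
  "seq_prod X t \<omega> = (\<Prod>i<nsteps t. Atilde X (t ! i) (nat (t ! (i + 1) - t ! i)) \<omega>)"

definition closed_pairs :: "(int list \<times> int list) set" where
  "closed_pairs = {(s, t). s \<in> seqs \<and> t \<in> seqs \<and> nsteps s > 0 \<and> nsteps t > 0 \<and>
     s ! nsteps s = t ! nsteps t \<and>
     (\<forall>i j. 0 < i \<and> i < nsteps s \<and> 0 < j \<and> j < nsteps t \<longrightarrow> s ! i \<noteq> t ! j)}"

text \<open>Matrix indices start at 0.\<close>

definition companion :: "nat \<Rightarrow> (nat \<Rightarrow> real) \<Rightarrow> real mat" where
  "companion p a = mat p p (\<lambda>(i, j). if i = 0 then a (j + 1) else if i = j + 1 then 1 else 0)"

definition kronecker_prod :: "'a::times mat \<Rightarrow> 'a mat \<Rightarrow> 'a mat" where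
  "kronecker_prod A B = mat (dim_row A * dim_row B) (dim_col A * dim_col B)
     (\<lambda>(i, j). A $$ (i div dim_row B, j div dim_col B) * B $$ (i mod dim_row B, j mod dim_col B))"

text \<open>The dimensions are arguments because those of a matrix-valued function
  are not recorded in its type.\<close>

definition nn_expectation_mat ::
  "'a measure \<Rightarrow> nat \<Rightarrow> nat \<Rightarrow> ('a \<Rightarrow> real mat) \<Rightarrow> ennreal mat" where
  "nn_expectation_mat M r c Y = mat r c (\<lambda>(i, j). \<integral>\<^sup>+\<omega>. ennreal (Y \<omega> $$ (i, j)) \<partial>M)"

definition ennreal_spectral_radius :: "ennreal mat \<Rightarrow> ennreal" where
  "ennreal_spectral_radius B =
     (if \<exists>i<dim_row B. \<exists>j<dim_col B. B $$ (i, j) = \<infinity> then \<infinity>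
      else ennreal (spectral_radius (map_mat (\<lambda>x. complex_of_real (enn2real x)) B)))"

end

theory Submission
  imports Defs
begin

unbundle no vec_syntax

text \<open>Read an index \<open>(i, k)\<close> of \<open>R = E[A \<otimes> A]\<close> as the remaining waiting times of two renewal
  processes driven by the same environment. From (0, 0) both processes draw a step, with weight
  \<open>E[A\<^sub>j A\<^sub>l]\<close>; from the other states at most one of them does, with weight \<open>E[A\<^sub>j]\<close>. By independence the sum
  over the closed pairs is the total weight of the first returns from (0, 0) to (0, 0).

  For a nonnegative matrix, \<open>\<rho>(R) < 1\<close> holds iff some \<open>G > 0\<close> satisfies \<open>R G < G\<close>. Given such a \<open>G\<close>,
  the weight \<open>F(i, k)\<close> of first passages from \<open>(i, k)\<close> to (0, 0) is at most \<open>G(i, k) / G(0, 0)\<close>, so the sum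
  over closed pairs, \<open>(R F)(0, 0)\<close>, is less than 1; and \<open>\<Sum> E[A\<^sub>j] \<ge> 1\<close> would give \<open>R 1 \<ge> 1\<close>, because
  \<open>E[Y\<^sup>2] \<ge> 2 E[Y] - 1\<close> for \<open>Y = \<Sum> A\<^sub>j\<close>. Conversely, \<open>F\<close> satisfies \<open>R F \<le> F\<close> with strict inequality at
  (0, 0), and \<open>F + \<epsilon> (1 + \<delta> (i + k))\<close> is strict everywhere when \<open>\<Sum> E[A\<^sub>j] < 1\<close>.\<close>

section \<open>Nonnegative matrices of spectral radius less than 1\<close>

lemma mult_pow_mat_commute:
  assumes "A \<in> carrier_mat n n"
  shows "A * A ^\<^sub>m k = A ^\<^sub>m k * (A :: 'a::comm_ring_1 mat)"
proof (induction k)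
  case (Suc k)
  have "A * (A ^\<^sub>m k * A) = A * A ^\<^sub>m k * A"
    using assms by (intro assoc_mult_mat[symmetric]) auto
  then show ?case using Suc by simp
qed (use assms in auto)

text \<open>The witness is a truncated Neumann series: for \<open>g\<close> = (1 + R + ... +
  R^(K-1)) 1 the sum telescopes to R \<open>g\<close> = \<open>g\<close> - 1 + R^K 1, and R^K 1 < 1
  for large \<open>K\<close> because the powers of R decay geometrically.\<close>

lemma spectral_radius_less_1_imp_supersolution:
  fixes R :: "real mat"
  assumes R: "R \<in> carrier_mat n n" and n: "n > 0"
    and nonneg: "\<And>i j. i < n \<Longrightarrow> j < n \<Longrightarrow> 0 \<le> R $$ (i, j)"
    and less: "spectral_radius (map_mat complex_of_real R) < 1"
  shows "\<exists>g. (\<forall>i<n. 0 < g i) \<and> (\<forall>i<n. (\<Sum>j<n. R $$ (i, j) * g j) < g i)"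
proof -
  let ?C = "map_mat complex_of_real R"
  have C: "?C \<in> carrier_mat n n" using R by simp
  define r where "r = spectral_radius ?C"
  have "r \<in> norm ` spectrum ?C" unfolding r_def by (rule spectral_radius_mem_max(1)[OF C n])
  then have r0: "0 \<le> r" by auto
  \<comment> \<open>This choice gives \<open>\<theta>\<close> > 1 while \<open>\<theta> * r\<close>
    = 2r / (1 + r) is still below 1. So the powers of the rescaled matrix \<open>D\<close> stay
    bounded, and the powers of R decay at least like (1 / \<open>\<theta>\<close>)^k.\<close>
  define \<theta> where "\<theta> = 2 / (1 + r)"
  have \<theta>: "\<theta> > 1" "\<theta> * r < 1" using r0 less unfolding \<theta>_def r_def[symmetric]
    by (auto simp: field_simps)
  define D where "D = complex_of_real \<theta> \<cdot>\<^sub>m ?C"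
  have D: "D \<in> carrier_mat n n" unfolding D_def using C by simp
  have "spectral_radius D < 1"
  proof -
    obtain ev where ev: "ev \<in> spectrum D" "spectral_radius D = norm ev"
      using spectral_radius_mem_max(1)[OF D n] by auto
    then obtain x where x: "x \<in> carrier_vec n" "x \<noteq> 0\<^sub>v n" "D *\<^sub>v x = ev \<cdot>\<^sub>v x"
      using D unfolding spectrum_def eigenvalue_def eigenvector_def by auto
    have "?C *\<^sub>v x = (ev / \<theta>) \<cdot>\<^sub>v x"
    proof (rule eq_vecI)
      fix i assume i: "i < dim_vec ((ev / \<theta>) \<cdot>\<^sub>v x)"
      have "(D *\<^sub>v x) $ i = \<theta> * (?C *\<^sub>v x) $ i"
        unfolding D_def using i x C by (simp add: scalar_prod_def sum_distrib_left mult.assoc)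
      then show "(?C *\<^sub>v x) $ i = ((ev / \<theta>) \<cdot>\<^sub>v x) $ i"
        using x i \<theta> by (simp add: field_simps)
    qed (use x C in auto)
    then have "ev / \<theta> \<in> spectrum ?C"
      using x C unfolding spectrum_def eigenvalue_def eigenvector_def by auto
    then have "norm (ev / \<theta>) \<le> r"
      unfolding r_def using spectral_radius_mem_max(2)[OF C n] by blast
    then have "norm ev \<le> \<theta> * r" using \<theta> by (simp add: norm_divide field_simps)
    then show ?thesis using ev \<theta> by linarith
  qed
  then obtain c where c: "\<And>k. norm_bound (D ^\<^sub>m k) c"
    using spectral_radius_jnf_norm_bound_less_1_upper_triangular[OF D] by blast
  \<comment> \<open>\<open>v k\<close> is R^k applied to the constant vector 1; by \<open>pw\<close>
    below, the complex vector \<open>D\<close>^k 1 is \<open>\<theta>\<close>^k times it.\<close>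
  define v where "v = (\<lambda>k. ((\<lambda>g i. \<Sum>j<n. R $$ (i, j) * g j) ^^ k) (\<lambda>_. 1 :: real))"
  have v0: "v 0 i = 1" for i by (simp add: v_def)
  have vS: "v (Suc k) i = (\<Sum>j<n. R $$ (i, j) * v k j)" for k i by (simp add: v_def)
  have v_nonneg: "0 \<le> v k i" if "i < n" for k i
    using that by (induction k arbitrary: i) (auto simp: v0 vS intro!: sum_nonneg nonneg mult_nonneg_nonneg)
  let ?e = "vec n (\<lambda>_. 1 :: complex)"
  have pw: "(D ^\<^sub>m k *\<^sub>v ?e) $ i = of_real (\<theta> ^ k * v k i)" if "i < n" for k i
    using that
  proof (induction k arbitrary: i)
    case 0
    then show ?case using D by (simp add: v0)
  next
    case (Suc k)
    have Dk: "D ^\<^sub>m k \<in> carrier_mat n n" using D by simp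
    have "D ^\<^sub>m Suc k *\<^sub>v ?e = D *\<^sub>v (D ^\<^sub>m k *\<^sub>v ?e)"
      using mult_pow_mat_commute[OF D, of k] assoc_mult_mat_vec[OF D Dk, of ?e] by simp
    then have "(D ^\<^sub>m Suc k *\<^sub>v ?e) $ i = (\<Sum>j<n. D $$ (i, j) * (D ^\<^sub>m k *\<^sub>v ?e) $ j)"
      using Suc.prems D Dk
      by (simp del: pow_mat.simps add: scalar_prod_def[of "Matrix.row D i"] atLeast0LessThan)
    also have "\<dots> = (\<Sum>j<n. of_real (\<theta> * R $$ (i, j) * (\<theta> ^ k * v k j)))"
    proof (intro sum.cong refl)
      fix j assume "j \<in> {..<n}"
      then have "D $$ (i, j) = of_real (\<theta> * R $$ (i, j))"
        and "(D ^\<^sub>m k *\<^sub>v ?e) $ j = of_real (\<theta> ^ k * v k j)"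
        using Suc.prems R by (simp add: D_def) (use \<open>j \<in> {..<n}\<close> Suc.IH in blast)
      then show "D $$ (i, j) * (D ^\<^sub>m k *\<^sub>v ?e) $ j = of_real (\<theta> * R $$ (i, j) * (\<theta> ^ k * v k j))"
        by simp
    qed
    also have "\<dots> = of_real (\<theta> ^ Suc k * v (Suc k) i)"
      unfolding vS of_real_sum[symmetric] by (simp add: sum_distrib_left mult_ac)
    finally show ?case .
  qed
  have bound: "v k i \<le> n * c * (1 / \<theta>) ^ k" if i: "i < n" for k i
  proof -
    have "\<theta> ^ k * v k i = norm ((D ^\<^sub>m k *\<^sub>v ?e) $ i)"
      using pw[OF i, of k] v_nonneg[OF i, of k] \<theta> by (simp add: norm_mult norm_power del: of_real_mult of_real_power)
    also have "\<dots> = norm (\<Sum>j<n. (D ^\<^sub>m k) $$ (i, j))"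
      using i D by (simp add: scalar_prod_def atLeast0LessThan)
    also have "\<dots> \<le> (\<Sum>j<n. c)"
      using i D c[of k] by (intro sum_norm_le) (auto simp: norm_bound_def)
    finally show ?thesis using \<theta> by (simp add: field_simps)
  qed
  have "(\<lambda>k. n * c * (1 / \<theta>) ^ k) \<longlonglongrightarrow> n * c * 0"
    using \<theta> by (intro tendsto_intros LIMSEQ_power_zero) auto
  then have "\<forall>\<^sub>F k in sequentially. n * c * (1 / \<theta>) ^ k < 1"
    by (intro order_tendstoD) auto
  then obtain K where K: "n * c * (1 / \<theta>) ^ K < 1"
    by (auto simp: eventually_sequentially)
  have vK: "v K i < 1" if "i < n" for i using bound[OF that, of K] K by linarith
  \<comment> \<open>This puts \<open>v 0\<close> = 1 among the summands of \<open>g\<close>, which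
    makes \<open>g\<close> positive.\<close>
  have "K > 0" using vK[OF n] v0 by (cases K) auto
  define g where "g = (\<lambda>i. \<Sum>k<K. v k i)"
  have Rg: "(\<Sum>j<n. R $$ (i, j) * g j) = g i - 1 + v K i" for i
  proof -
    have "(\<Sum>j<n. R $$ (i, j) * g j) = (\<Sum>k<K. v (Suc k) i)"
      unfolding g_def vS by (simp add: sum_distrib_left sum.swap[of _ "{..<n}"])
    also have "\<dots> = g i - 1 + v K i"
      using sum.lessThan_Suc_shift[of "\<lambda>k. v k i" K] by (simp add: g_def v0)
    finally show ?thesis .
  qed
  have "g i > 0" if "i < n" for i
  proof -
    have "v 0 i \<le> g i" unfolding g_def
      using that \<open>K > 0\<close> by (intro member_le_sum) (auto intro: v_nonneg)
    then show ?thesis by (simp add: v0)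
  qed
  then show ?thesis using vK by (intro exI[of _ g]) (force simp: Rg)
qed

text \<open>Measure an eigenvector \<open>x\<close> in the maximum norm weighted by
  \<open>g\<close>. At an index \<open>i\<close> where |x_i| / g_i attains its maximum
  \<open>t\<close>, nonnegativity gives |ev| |x_i| <= t (R g)_i < t g_i = |x_i|.\<close>

lemma supersolution_imp_spectral_radius_less_1:
  fixes R :: "real mat"
  assumes R: "R \<in> carrier_mat n n" and n: "n > 0"
    and nonneg: "\<And>i j. i < n \<Longrightarrow> j < n \<Longrightarrow> 0 \<le> R $$ (i, j)"
    and pos: "\<And>i. i < n \<Longrightarrow> 0 < g i"
    and super: "\<And>i. i < n \<Longrightarrow> (\<Sum>j<n. R $$ (i, j) * g j) < g i"
  shows "spectral_radius (map_mat complex_of_real R) < 1"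
proof -
  let ?C = "map_mat complex_of_real R"
  have C: "?C \<in> carrier_mat n n" using R by simp
  obtain ev where ev: "ev \<in> spectrum ?C" "spectral_radius ?C = norm ev"
    using spectral_radius_mem_max(1)[OF C n] by auto
  then obtain x where x: "x \<in> carrier_vec n" "x \<noteq> 0\<^sub>v n" "?C *\<^sub>v x = ev \<cdot>\<^sub>v x"
    using C unfolding spectrum_def eigenvalue_def eigenvector_def by auto
  define t where "t = Max ((\<lambda>i. norm (x $ i) / g i) ` {..<n})"
  have le: "norm (x $ j) \<le> t * g j" if "j < n" for j
  proof -
    have "norm (x $ j) / g j \<le> t" unfolding t_def using that by (intro Max_ge) auto
    then show ?thesis using pos[OF that] by (simp add: field_simps)
  qed
  have "t \<in> (\<lambda>i. norm (x $ i) / g i) ` {..<n}"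
    unfolding t_def using n by (intro Max_in) auto
  then obtain i where i: "i < n" "t = norm (x $ i) / g i" by auto
  obtain j where j: "j < n" "x $ j \<noteq> 0" using x by (metis carrier_vecD eq_vecI index_zero_vec)
  have t: "t > 0" using le[OF j(1)] j pos[OF j(1)] by (smt (verit) zero_less_mult_iff zero_less_norm_iff)
  have "norm ev * norm (x $ i) = norm ((?C *\<^sub>v x) $ i)"
    unfolding x(3) using x(1) i by (simp add: norm_mult)
  also have "\<dots> = norm (\<Sum>j<n. of_real (R $$ (i, j)) * x $ j)"
    using i x(1) R by (simp add: scalar_prod_def atLeast0LessThan)
  also have "\<dots> \<le> (\<Sum>j<n. R $$ (i, j) * (t * g j))"
  proof (rule sum_norm_le)
    fix j assume "j \<in> {..<n}"
    then show "norm (of_real (R $$ (i, j)) * x $ j) \<le> R $$ (i, j) * (t * g j)"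
      using nonneg[OF i(1)] mult_left_mono[OF le nonneg[OF i(1)]] by (simp add: norm_mult)
  qed
  also have "\<dots> = t * (\<Sum>j<n. R $$ (i, j) * g j)" by (simp add: sum_distrib_left mult_ac)
  also have "\<dots> < t * g i" using t super[OF i(1)] by simp
  also have "\<dots> = norm (x $ i)" using i pos[OF i(1)] by simp
  finally have "norm ev < 1"
    using mult_right_mono[of 1 "norm ev" "norm (x $ i)"] by fastforce
  then show ?thesis using ev by simp
qed

section \<open>First meetings of two paths\<close>

text \<open>Two walkers at \<open>x\<close> and \<open>y\<close>, of whom the one behind moves next, until they meet; \<open>n\<close> bounds the
  number of moves. Since the one behind always moves, an agreement of two interior points of the paths
  would already have been the meeting.\<close>

fun meeting_weight :: "nat \<Rightarrow> (nat \<Rightarrow> ennreal) \<Rightarrow> nat \<Rightarrow> int \<Rightarrow> int \<Rightarrow> ennreal" where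
  "meeting_weight p m 0 x y = (if x = y then 1 else 0)"
| "meeting_weight p m (Suc n) x y =
     (if x = y then 1
      else if x < y then \<Sum>j=1..p. m j * meeting_weight p m n (x + int j) y
      else \<Sum>j=1..p. m j * meeting_weight p m n x (y + int j))"

text \<open>The same recursion as for \<open>meeting_weight\<close>, recording the paths instead of
  their weights. The steps are cut off at \<open>p\<close> to keep the sets finite; longer ones will
  have weight 0.\<close>

fun meeting_pairs :: "nat \<Rightarrow> nat \<Rightarrow> int \<Rightarrow> int \<Rightarrow> (int list \<times> int list) set" where
  "meeting_pairs p 0 x y = (if x = y then {([x], [y])} else {})"
| "meeting_pairs p (Suc n) x y =
     (if x = y then {([x], [y])}
      else if x < y then \<Union>j\<in>{1..p}. apfst ((#) x) ` meeting_pairs p n (x + int j) y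
      else \<Union>j\<in>{1..p}. apsnd ((#) y) ` meeting_pairs p n x (y + int j))"

definition path_weight :: "(nat \<Rightarrow> ennreal) \<Rightarrow> int list \<Rightarrow> ennreal" where
  "path_weight m s = (\<Prod>i<nsteps s. m (nat (s ! (i + 1) - s ! i)))"

lemma path_weight_singleton [simp]: "path_weight m [x] = 1"
  by (simp add: path_weight_def nsteps_def)

lemma path_weight_Cons:
  "s \<noteq> [] \<Longrightarrow> path_weight m (x # s) = m (nat (hd s - x)) * path_weight m s"
  by (cases s) (simp_all add: path_weight_def nsteps_def prod.lessThan_Suc_shift del: prod.lessThan_Suc)

text \<open>Only the last points are exempt from disjointness; the starting points are not. In a
  closed pair with the common start 0 removed, the new starting points are interior points of the
  original paths unless they are already the end.\<close>

definition first_meeting :: "int list \<Rightarrow> int list \<Rightarrow> bool" where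
  "first_meeting s t \<longleftrightarrow> s \<noteq> [] \<and> t \<noteq> [] \<and> sorted_wrt (<) s \<and> sorted_wrt (<) t \<and>
     last s = last t \<and> set (butlast s) \<inter> set (butlast t) = {}"

lemma hd_le_last_sorted: "sorted_wrt (<) s \<Longrightarrow> s \<noteq> [] \<Longrightarrow> hd s \<le> (last s :: int)"
  by (cases s) (auto simp: less_imp_le)

lemma hd_le_sorted: "sorted_wrt (<) s \<Longrightarrow> x \<in> set s \<Longrightarrow> hd s \<le> (x :: int)"
  by (cases s) (auto simp: less_imp_le)

lemma sorted_Cons_hd: "s \<noteq> [] \<Longrightarrow> sorted_wrt (<) (x # s) \<longleftrightarrow> (x :: int) < hd s \<and> sorted_wrt (<) s"
  using hd_le_sorted[of s] by (auto dest: order.strict_trans2)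

lemma first_meeting_commute: "first_meeting s t \<longleftrightarrow> first_meeting t s"
  unfolding first_meeting_def by auto

text \<open>A point behind the whole of \<open>t\<close> cannot collide with \<open>t\<close>, so
  only the monotonicity of \<open>x # s\<close> is at stake. This is why moving the walker behind
  never misses a meeting.\<close>

lemma first_meeting_Cons_left:
  assumes "s \<noteq> []" "t \<noteq> []" "x < hd t"
  shows "first_meeting (x # s) t \<longleftrightarrow> x < hd s \<and> first_meeting s t"
proof -
  have "x \<notin> set (butlast t)" if "sorted_wrt (<) t"
    using hd_le_sorted[OF that, of x] assms by (auto dest: in_set_butlastD)
  then show ?thesis
    unfolding first_meeting_def sorted_Cons_hd[OF assms(1)] using assms by auto
qed

text \<open>If both paths went on, their common head would lie in both \<open>butlast\<close>s. If
  just one of them stopped, the other would have to return to its head as its last point, against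
  strict monotonicity.\<close>

lemma first_meeting_eq_hd:
  assumes "first_meeting s t" "hd s = hd t"
  shows "s = [hd s] \<and> t = [hd s]"
proof -
  obtain x s' t' where *: "s = x # s'" "t = x # t'"
    using assms by (cases s; cases t) (auto simp: first_meeting_def)
  have "s' = [] \<or> t' = []"
    using assms unfolding * first_meeting_def by auto
  moreover have "s' = [] \<longleftrightarrow> t' = []"
    using assms last_in_set[of s'] last_in_set[of t'] unfolding * first_meeting_def
    by (auto split: if_splits)
  ultimately show ?thesis unfolding * by simp
qed

lemma meeting_pairs_first_meeting:
  "(s, t) \<in> meeting_pairs p n x y \<Longrightarrow> first_meeting s t \<and> hd s = x \<and> hd t = y"
proof (induction p n x y arbitrary: s t rule: meeting_pairs.induct)
  case (1 p x y)
  then show ?case by (auto simp: first_meeting_def split: if_splits)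
next
  case (2 p n x y)
  consider "x = y" | "x < y" | "y < x" by linarith
  then show ?case
  proof cases
    case 1
    then show ?thesis using 2 by (auto simp: first_meeting_def)
  next
    case c: 2
    then obtain j s' where j: "j \<in> {1..p}" "s = x # s'" "(s', t) \<in> meeting_pairs p n (x + int j) y"
      using 2(3) by auto
    have IH: "first_meeting s' t" "hd s' = x + int j" "hd t = y" using 2(1)[OF _ c j(1,3)] c by auto
    then have "s' \<noteq> []" "t \<noteq> []" by (auto simp: first_meeting_def)
    then show ?thesis using first_meeting_Cons_left[of s' t x] IH j c by simp
  next
    case c: 3
    then obtain j t' where j: "j \<in> {1..p}" "t = y # t'" "(s, t') \<in> meeting_pairs p n x (y + int j)"
      using 2(3) by auto
    have IH: "first_meeting s t'" "hd t' = y + int j" "hd s = x" using 2(2)[OF _ _ j(1,3)] c by auto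
    then have "s \<noteq> []" "t' \<noteq> []" by (auto simp: first_meeting_def)
    then show ?thesis using first_meeting_Cons_left[of t' s y] IH j c
      by (simp add: first_meeting_commute)
  qed
qed

text \<open>The total number of moves is \<open>length s + length t - 2\<close>, hence the length
  bound. A nonzero weight rules out steps longer than \<open>p\<close>, which
  \<open>meeting_pairs\<close> does not list.\<close>

lemma first_meeting_in_meeting_pairs:
  assumes m: "\<And>j. j > p \<Longrightarrow> m j = 0"
  shows "first_meeting s t \<Longrightarrow> length s + length t \<le> n + 2 \<Longrightarrow> path_weight m s * path_weight m t \<noteq> 0 \<Longrightarrow>
    (s, t) \<in> meeting_pairs p n (hd s) (hd t)"
proof (induction n arbitrary: s t)
  case 0
  then have "s \<noteq> []" "t \<noteq> []" by (auto simp: first_meeting_def)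
  then have "length s = 1" "length t = 1" using 0(2) by (cases s; cases t; simp)+
  then obtain a b where "s = [a]" "t = [b]" by (auto simp: length_Suc_conv)
  then show ?case using 0 by (simp add: first_meeting_def)
next
  case (Suc n)
  have step: "\<exists>s'. s = hd s # s' \<and> hd s' \<in> (\<lambda>j. hd s + int j) ` {1..p} \<and> first_meeting s' t \<and>
      path_weight m s' \<noteq> 0 \<and> hd s < hd t"
    if st: "first_meeting s t" "hd s < hd t" "path_weight m s \<noteq> 0" for s t
  proof -
    obtain x s' where s: "s = x # s'" using st by (cases s) (auto simp: first_meeting_def)
    \<comment> \<open>Otherwise the walker behind would already be at the common last point, which
      is at least \<open>hd t\<close>.\<close>
    have "s' \<noteq> []" using hd_le_last_sorted[of t] st s by (auto simp: first_meeting_def)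
    moreover have "t \<noteq> []" using st by (auto simp: first_meeting_def)
    ultimately have *: "x < hd s'" "first_meeting s' t"
      using first_meeting_Cons_left[of s' t x] st s by auto
    have "m (nat (hd s' - x)) * path_weight m s' \<noteq> 0"
      using st s path_weight_Cons[OF \<open>s' \<noteq> []\<close>, of m x] by simp
    then have "m (nat (hd s' - x)) \<noteq> 0" "path_weight m s' \<noteq> 0" by auto
    then have "nat (hd s' - x) \<le> p" using m by (meson not_le)
    then have "hd s' \<in> (\<lambda>j. x + int j) ` {1..p}"
      using * by (intro image_eqI[of _ _ "nat (hd s' - x)"]) auto
    then show ?thesis using * s \<open>path_weight m s' \<noteq> 0\<close> st by auto
  qed
  consider "hd s = hd t" | "hd s < hd t" | "hd t < hd s" by linarith
  then show ?case
  proof cases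
    case 1
    then show ?thesis using first_meeting_eq_hd[OF Suc.prems(1)] by (metis meeting_pairs.simps(2) singletonI)
  next
    case 2
    then obtain s' j where s': "s = hd s # s'" "j \<in> {1..p}" "hd s' = hd s + int j" "first_meeting s' t"
       "path_weight m s' \<noteq> 0"
      using step[of s t] Suc.prems by auto
    have "length s = Suc (length s')" by (subst s'(1)) simp
    then have "(s', t) \<in> meeting_pairs p n (hd s') (hd t)"
      using Suc.IH[OF s'(4)] Suc.prems s' by auto
    then have "(s', t) \<in> meeting_pairs p n (hd s + int j) (hd t)" using s' by simp
    then have "apfst ((#) (hd s)) (s', t) \<in> meeting_pairs p (Suc n) (hd s) (hd t)"
      using 2 s' by (simp only: meeting_pairs.simps if_False if_True less_imp_neq) blast
    then show ?thesis using s'(1) by simp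
  next
    case 3
    then obtain t' j where t': "t = hd t # t'" "j \<in> {1..p}" "hd t' = hd t + int j" "first_meeting t' s"
       "path_weight m t' \<noteq> 0"
      using step[of t s] Suc.prems by (auto simp: first_meeting_commute)
    have "length t = Suc (length t')" by (subst t'(1)) simp
    then have "(s, t') \<in> meeting_pairs p n (hd s) (hd t')"
      using Suc.IH[of s t'] Suc.prems t' by (auto simp: first_meeting_commute)
    then have "(s, t') \<in> meeting_pairs p n (hd s) (hd t + int j)" using t' by simp
    moreover have "hd s \<noteq> hd t" "\<not> hd s < hd t" using 3 by auto
    ultimately have "apsnd ((#) (hd t)) (s, t') \<in> meeting_pairs p (Suc n) (hd s) (hd t)"
      using t' by (simp only: meeting_pairs.simps if_False if_True) blast
    then show ?thesis using t'(1) by simp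
  qed
qed

lemma finite_meeting_pairs [simp]: "finite (meeting_pairs p n x y)"
  by (induction p n x y rule: meeting_pairs.induct) auto

lemma sum_meeting_pairs:
  "(\<Sum>(s, t)\<in>meeting_pairs p n x y. path_weight m s * path_weight m t) = meeting_weight p m n x y"
proof (induction p n x y rule: meeting_pairs.induct)
  case (1 p x y)
  then show ?case by simp
next
  case (2 p n x y)
  let ?f = "\<lambda>(s, t). path_weight m s * path_weight m t"
  consider "x = y" | "x < y" | "y < x" by linarith
  then show ?case
  proof cases
    case 1
    then show ?thesis by simp
  next
    case c: 2
    have "sum ?f (meeting_pairs p (Suc n) x y) =
      sum ?f (\<Union>j\<in>{1..p}. apfst ((#) x) ` meeting_pairs p n (x + int j) y)"
      using c by simp
    also have "\<dots> = (\<Sum>j=1..p. sum ?f (apfst ((#) x) ` meeting_pairs p n (x + int j) y))"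
      \<comment> \<open>The first component of each pair found after a step \<open>j\<close> has
        second point \<open>x + int j\<close>, so different steps give disjoint sets.\<close>
      by (intro sum.UNION_disjoint) (auto dest!: meeting_pairs_first_meeting)
    also have "\<dots> = (\<Sum>j=1..p. m j * sum ?f (meeting_pairs p n (x + int j) y))"
    proof (intro sum.cong refl)
      fix j
      have "sum ?f (apfst ((#) x) ` meeting_pairs p n (x + int j) y) =
        (\<Sum>(s, t)\<in>meeting_pairs p n (x + int j) y. path_weight m (x # s) * path_weight m t)"
        by (subst sum.reindex) (auto simp: inj_on_def intro!: sum.cong)
      also have "\<dots> = (\<Sum>(s, t)\<in>meeting_pairs p n (x + int j) y. m j * (path_weight m s * path_weight m t))"
      proof (intro sum.cong refl, clarify)
        fix s t assume "(s, t) \<in> meeting_pairs p n (x + int j) y"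
        then have "s \<noteq> []" "hd s = x + int j"
          using meeting_pairs_first_meeting by (force simp: first_meeting_def)+
        then show "path_weight m (x # s) * path_weight m t = m j * (path_weight m s * path_weight m t)"
          by (simp add: path_weight_Cons mult.assoc)
      qed
      finally show "sum ?f (apfst ((#) x) ` meeting_pairs p n (x + int j) y) =
          m j * sum ?f (meeting_pairs p n (x + int j) y)"
        by (simp add: sum_distrib_left split_def)
    qed
    finally show ?thesis using c 2(1) by simp
  next
    case c: 3
    have "sum ?f (meeting_pairs p (Suc n) x y) =
      sum ?f (\<Union>j\<in>{1..p}. apsnd ((#) y) ` meeting_pairs p n x (y + int j))"
      using c by simp
    also have "\<dots> = (\<Sum>j=1..p. sum ?f (apsnd ((#) y) ` meeting_pairs p n x (y + int j)))"
      by (intro sum.UNION_disjoint) (auto dest!: meeting_pairs_first_meeting)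
    also have "\<dots> = (\<Sum>j=1..p. m j * sum ?f (meeting_pairs p n x (y + int j)))"
    proof (intro sum.cong refl)
      fix j
      have "sum ?f (apsnd ((#) y) ` meeting_pairs p n x (y + int j)) =
        (\<Sum>(s, t)\<in>meeting_pairs p n x (y + int j). path_weight m s * path_weight m (y # t))"
        by (subst sum.reindex) (auto simp: inj_on_def intro!: sum.cong)
      also have "\<dots> = (\<Sum>(s, t)\<in>meeting_pairs p n x (y + int j). m j * (path_weight m s * path_weight m t))"
      proof (intro sum.cong refl, clarify)
        fix s t assume "(s, t) \<in> meeting_pairs p n x (y + int j)"
        then have "t \<noteq> []" "hd t = y + int j"
          using meeting_pairs_first_meeting by (force simp: first_meeting_def)+
        then show "path_weight m s * path_weight m (y # t) = m j * (path_weight m s * path_weight m t)"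
          by (simp add: path_weight_Cons mult_ac)
      qed
      finally show "sum ?f (apsnd ((#) y) ` meeting_pairs p n x (y + int j)) =
          m j * sum ?f (meeting_pairs p n x (y + int j))"
        by (simp add: sum_distrib_left split_def)
    qed
    finally show ?thesis using c 2(2) by simp
  qed
qed

section \<open>Summing over closed pairs: a joint first step followed by a first meeting\<close>

lemma closed_pairs_iff:
  "(s, t) \<in> closed_pairs \<longleftrightarrow>
     (\<exists>s' t'. s = 0 # s' \<and> t = 0 # t' \<and> 0 < hd s' \<and> 0 < hd t' \<and> first_meeting s' t')"
proof -
  have *: "(\<forall>i j. 0 < i \<and> i < nsteps (a # s') \<and> 0 < j \<and> j < nsteps (b # t') \<longrightarrow> (a # s') ! i \<noteq> (b # t') ! j)
    \<longleftrightarrow> set (butlast s') \<inter> set (butlast t') = {}" (is "?l \<longleftrightarrow> ?r")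
    if "s' \<noteq> []" "t' \<noteq> []" for s' t' and a b :: int
  proof -
    have "?l \<longleftrightarrow> (\<forall>i j. i < length s' - 1 \<and> j < length t' - 1 \<longrightarrow> s' ! i \<noteq> t' ! j)"
    proof (intro iffI allI impI)
      fix i j assume l: ?l and ij: "i < length s' - 1 \<and> j < length t' - 1"
      then show "s' ! i \<noteq> t' ! j"
        using l[rule_format, of "Suc i" "Suc j"] by (simp add: nsteps_def less_diff_conv)
    next
      fix i j assume r: "\<forall>i j. i < length s' - 1 \<and> j < length t' - 1 \<longrightarrow> s' ! i \<noteq> t' ! j"
        and ij: "0 < i \<and> i < nsteps (a # s') \<and> 0 < j \<and> j < nsteps (b # t')"
      moreover from ij obtain i' j' where "i = Suc i'" "j = Suc j'"
        by (auto simp: gr0_conv_Suc)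
      ultimately show "(a # s') ! i \<noteq> (b # t') ! j"
        using r[rule_format, of i' j'] by (simp add: nsteps_def less_diff_conv)
    qed
    also have "\<dots> \<longleftrightarrow> ?r"
    proof -
      have "set (butlast u) = (!) u ` {..<length u - 1}" for u :: "int list"
        using nth_image[of "length u - 1" u] by (simp add: butlast_conv_take atLeast0LessThan)
      then show ?thesis by force
    qed
    finally show ?thesis .
  qed
  have last: "(a # s') ! nsteps (a # s') = last s'" if "s' \<noteq> []" for s' and a :: int
    using that by (simp add: nsteps_def last_conv_nth nth_Cons')
  show ?thesis
  proof
    assume c: "(s, t) \<in> closed_pairs"
    then obtain s' t' where st: "s = 0 # s'" "t = 0 # t'" "s' \<noteq> []" "t' \<noteq> []"
      by (cases s; cases t) (auto simp: closed_pairs_def seqs_def nsteps_def)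
    then show "\<exists>s' t'. s = 0 # s' \<and> t = 0 # t' \<and> 0 < hd s' \<and> 0 < hd t' \<and> first_meeting s' t'"
      using c *[OF st(3,4), of 0 0] last[OF st(3), of 0] last[OF st(4), of 0]
      unfolding closed_pairs_def seqs_def first_meeting_def
      by (auto simp: sorted_Cons_hd simp del: sorted_wrt.simps)
  next
    assume "\<exists>s' t'. s = 0 # s' \<and> t = 0 # t' \<and> 0 < hd s' \<and> 0 < hd t' \<and> first_meeting s' t'"
    then obtain s' t' where st: "s = 0 # s'" "t = 0 # t'" "0 < hd s'" "0 < hd t'" "first_meeting s' t'"
      by blast
    then have ne: "s' \<noteq> []" "t' \<noteq> []" by (auto simp: first_meeting_def)
    then have "nsteps s > 0" "nsteps t > 0" unfolding st nsteps_def by auto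
    then show "(s, t) \<in> closed_pairs"
      using st ne *[OF ne, of 0 0] last[OF ne(1), of 0] last[OF ne(2), of 0]
      unfolding closed_pairs_def seqs_def first_meeting_def
      by (auto simp: sorted_Cons_hd simp del: sorted_wrt.simps)
  qed
qed

text \<open>The weight \<open>S\<close> of the two first steps is kept joint, since both start at
  time 0 and use the same environment. The remaining paths carry product weights. Finite sets of
  pairs reached within \<open>n\<close> moves exhaust all closed pairs of nonzero weight.\<close>

lemma infsum_closed_pairs:
  fixes m :: "nat \<Rightarrow> ennreal" and S :: "nat \<Rightarrow> nat \<Rightarrow> ennreal"
  assumes m: "\<And>j. j > p \<Longrightarrow> m j = 0"
    and S: "\<And>j l. j > p \<or> l > p \<Longrightarrow> S j l = 0"
  shows "(\<Sum>\<^sub>\<infinity>(s, t)\<in>closed_pairs. S (nat (s ! 1)) (nat (t ! 1)) * (path_weight m (tl s) * path_weight m (tl t))) =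
    (SUP n. \<Sum>j=1..p. \<Sum>l=1..p. S j l * meeting_weight p m n (int j) (int l))" (is "infsum ?w _ = (SUP n. ?W n)")
proof -
  \<comment> \<open>The indices \<open>(j, l)\<close> are the heads of \<open>s\<close> and
    \<open>t\<close>, so they are determined by the pair, and prepending 0 is injective
    here.\<close>
  define D where "D n = (\<lambda>((j :: nat, l :: nat), (s :: int list, t)). (0 # s, 0 # t)) `
    (SIGMA (j, l):{1..p} \<times> {1..p}. meeting_pairs p n (int j) (int l))" for n
  have finD: "finite (D n)" for n
    unfolding D_def by (intro finite_imageI finite_SigmaI) auto
  have sumD: "sum ?w (D n) = ?W n" for n
  proof -
    have "inj_on (\<lambda>((j :: nat, l :: nat), (s :: int list, t)). (0 # s, 0 # t))
      (SIGMA (j, l):{1..p} \<times> {1..p}. meeting_pairs p n (int j) (int l))"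
      by (auto simp: inj_on_def dest!: meeting_pairs_first_meeting)
    then have "sum ?w (D n) = (\<Sum>((j, l), s, t)\<in>(SIGMA (j, l):{1..p} \<times> {1..p}. meeting_pairs p n (int j) (int l)).
        S (nat (hd s)) (nat (hd t)) * (path_weight m s * path_weight m t))"
      unfolding D_def
      by (subst sum.reindex)
        (auto simp: first_meeting_def hd_conv_nth intro!: sum.cong dest!: meeting_pairs_first_meeting)
    also have "\<dots> = (\<Sum>((j, l), s, t)\<in>(SIGMA (j, l):{1..p} \<times> {1..p}. meeting_pairs p n (int j) (int l)).
        S j l * (path_weight m s * path_weight m t))"
      by (intro sum.cong) (auto dest!: meeting_pairs_first_meeting)
    also have "\<dots> = (\<Sum>jl\<in>{1..p} \<times> {1..p}. \<Sum>st\<in>meeting_pairs p n (int (fst jl)) (int (snd jl)).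
        S (fst jl) (snd jl) * (path_weight m (fst st) * path_weight m (snd st)))"
      by (subst sum.Sigma) (auto simp: split_def)
    also have "\<dots> = (\<Sum>jl\<in>{1..p} \<times> {1..p}. S (fst jl) (snd jl) * meeting_weight p m n (int (fst jl)) (int (snd jl)))"
      by (simp add: sum_meeting_pairs[symmetric] sum_distrib_left split_def)
    also have "\<dots> = ?W n"
      by (subst sum.Sigma) (auto simp: split_def)
    finally show ?thesis .
  qed
  have D_closed: "D n \<subseteq> closed_pairs" for n
    unfolding D_def by (auto simp: closed_pairs_iff dest!: meeting_pairs_first_meeting)
  have SUP: "infsum ?w closed_pairs = (SUP P\<in>{P. finite P \<and> P \<subseteq> closed_pairs}. sum ?w P)"
    by (rule nonneg_infsum_complete) simp
  show ?thesis
  proof (rule antisym)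
    show "infsum ?w closed_pairs \<le> (SUP n. ?W n)"
      unfolding SUP
    proof (rule SUP_least, clarify)
      fix P assume P: "finite P" "P \<subseteq> closed_pairs"
      \<comment> \<open>The sum of all lengths is a crude bound for the length of every single pair
        in \<open>P\<close>.\<close>
      define n where "n = (\<Sum>(s, t)\<in>P. length s + length t)"
      have "{x \<in> P. ?w x \<noteq> 0} \<subseteq> D n"
      proof
        fix x assume x: "x \<in> {x \<in> P. ?w x \<noteq> 0}"
        then obtain s t where st: "x = (0 # s, 0 # t)" "0 < hd s" "0 < hd t" "first_meeting s t"
          using P by (cases x) (auto simp: closed_pairs_iff dest!: subsetD)
        then have ne: "s \<noteq> []" "t \<noteq> []" by (auto simp: first_meeting_def)
        have "S (nat (hd s)) (nat (hd t)) \<noteq> 0" "path_weight m s * path_weight m t \<noteq> 0"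
          using x st ne by (auto simp: hd_conv_nth)
        moreover from this have "nat (hd s) \<in> {1..p}" "nat (hd t) \<in> {1..p}"
          using S st(2,3) by (metis atLeastAtMost_iff One_nat_def Suc_leI not_le zero_less_nat_eq)+
        moreover have "length s + length t \<le> n + 2"
        proof -
          have "(case x of (s, t) \<Rightarrow> length s + length t) \<le> n"
            unfolding n_def using P x by (intro member_le_sum) auto
          then show ?thesis using st by simp
        qed
        ultimately have "((nat (hd s), nat (hd t)), (s, t)) \<in>
          (SIGMA (j, l):{1..p} \<times> {1..p}. meeting_pairs p n (int j) (int l))"
          using first_meeting_in_meeting_pairs[of p m s t n, OF _ st(4)] m st(2,3) by simp
        then show "x \<in> D n" unfolding D_def st(1) by (rule rev_image_eqI) simp
      qed
      have "sum ?w P = sum ?w {x \<in> P. ?w x \<noteq> 0}"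
        using P by (intro sum.mono_neutral_right) auto
      also have "\<dots> \<le> sum ?w (D n)"
        using \<open>_ \<subseteq> D n\<close> finD by (intro sum_mono2) auto
      also have "\<dots> \<le> (SUP n. ?W n)" unfolding sumD by (rule SUP_upper) simp
      finally show "sum ?w P \<le> (SUP n. ?W n)" .
    qed
    show "(SUP n. ?W n) \<le> infsum ?w closed_pairs"
      unfolding SUP sumD[symmetric] by (intro SUP_least SUP_upper) (use finD D_closed in auto)
  qed
qed

section \<open>Meeting weights without a bound on the moves, and their supersolutions\<close>

lemma meeting_weight_translate:
  "meeting_weight p m n (x + c) (y + c) = meeting_weight p m n x y"
  by (induction p m n x y rule: meeting_weight.induct) (auto simp: add_ac intro!: sum.cong)

lemma meeting_weight_le_Suc: "meeting_weight p m n x y \<le> meeting_weight p m (Suc n) x y"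
proof (induction n arbitrary: x y)
  case (Suc n)
  show ?case
    unfolding meeting_weight.simps(2)[of p m "Suc n" x y] meeting_weight.simps(2)[of p m n x y]
    using Suc by (auto intro!: sum_mono mult_left_mono simp del: meeting_weight.simps)
qed simp

lemma incseq_meeting_weight: "incseq (\<lambda>n. meeting_weight p m n x y)"
  by (intro incseq_SucI meeting_weight_le_Suc)

text \<open>The hypotheses say R G <= G away from (0, 0), one for each kind of row. They suffice for
  an induction on the number of moves: by translation invariance the waiting times can be taken as
  positions, and letting both walkers wait is a common shift.\<close>

lemma meeting_weight_le_supersolution:
  fixes G :: "nat \<Rightarrow> nat \<Rightarrow> ennreal"
  assumes diag: "1 \<le> G 0 0"
    and shift: "\<And>i k. Suc i < p \<Longrightarrow> Suc k < p \<Longrightarrow> G i k \<le> G (Suc i) (Suc k)"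
    and left: "\<And>k. Suc k < p \<Longrightarrow> (\<Sum>j<p. m (Suc j) * G j k) \<le> G 0 (Suc k)"
    and right: "\<And>i. Suc i < p \<Longrightarrow> (\<Sum>l<p. m (Suc l) * G i l) \<le> G (Suc i) 0"
  shows "i < p \<Longrightarrow> k < p \<Longrightarrow> meeting_weight p m n (int i) (int k) \<le> G i k"
proof (induction n arbitrary: i k)
  have shifts: "G i k \<le> G (i + d) (k + d)" if "i + d < p" "k + d < p" for i k d
    using that by (induction d) (auto intro: order.trans shift)
  have diags: "1 \<le> G i i" if "i < p" for i
    using shifts[of 0 i 0] diag that by (auto intro: order.trans)
  case 0
  then show ?case by (auto intro: diags)
  case (Suc n)
  consider "i = k" | "i < k" | "k < i" by linarith
  then show ?case
  proof cases
    case 1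
    then show ?thesis using diags Suc.prems by simp
  next
    case 2
    \<comment> \<open>After the walker at \<open>i\<close> moves by \<open>Suc j\<close>, both
      positions are lowered by \<open>Suc i\<close>. They become \<open>j\<close> and
      \<open>d\<close>, again below \<open>p\<close>, where the induction hypothesis applies;
      \<open>shifts\<close> then restores the offset \<open>i\<close>.\<close>
    define d where "d = k - Suc i"
    have k: "k = Suc d + i" using 2 by (simp add: d_def)
    have "meeting_weight p m (Suc n) (int i) (int k) = (\<Sum>j<p. m (Suc j) * meeting_weight p m n (int j + int (Suc i)) (int d + int (Suc i)))"
      using 2 k by (simp add: sum.atLeast1_atMost_eq add_ac)
    also have "\<dots> \<le> (\<Sum>j<p. m (Suc j) * G j d)"
      unfolding meeting_weight_translate using Suc k by (intro sum_mono mult_left_mono) auto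
    also have "\<dots> \<le> G 0 (Suc d)" using Suc.prems k by (intro left) auto
    also have "\<dots> \<le> G i k" using shifts[of 0 i "Suc d"] Suc.prems k by simp
    finally show ?thesis .
  next
    case 3
    define d where "d = i - Suc k"
    have i: "i = Suc d + k" using 3 by (simp add: d_def)
    have "meeting_weight p m (Suc n) (int i) (int k) = (\<Sum>j<p. m (Suc j) * meeting_weight p m n (int d + int (Suc k)) (int j + int (Suc k)))"
      using 3 i by (simp add: sum.atLeast1_atMost_eq add_ac)
    also have "\<dots> \<le> (\<Sum>j<p. m (Suc j) * G d j)"
      unfolding meeting_weight_translate using Suc i by (intro sum_mono mult_left_mono) auto
    also have "\<dots> \<le> G (Suc d) 0" using Suc.prems i by (intro right) auto
    also have "\<dots> \<le> G i k" using shifts[of "Suc d" k 0] Suc.prems i by simp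
    finally show ?thesis .
  qed
qed

text \<open>The total weight of all first meetings from \<open>x\<close> and \<open>y\<close>. At
  waiting times (i, k) it is the first passage weight F(i, k) to the state (0, 0).\<close>

definition meeting_limit :: "nat \<Rightarrow> (nat \<Rightarrow> ennreal) \<Rightarrow> int \<Rightarrow> int \<Rightarrow> ennreal" where
  "meeting_limit p m x y = (SUP n. meeting_weight p m n x y)"

lemma meeting_limit_same [simp]: "meeting_limit p m x x = 1"
proof -
  have "meeting_weight p m n x x = 1" for n by (cases n) auto
  then show ?thesis by (simp add: meeting_limit_def)
qed

lemma meeting_limit_translate:
  "meeting_limit p m (x + c) (y + c) = meeting_limit p m x y"
  by (simp add: meeting_limit_def meeting_weight_translate)

lemma sum_mult_meeting_limit:
  "(\<Sum>i\<in>I. c i * meeting_limit p m (x i) (y i)) = (SUP n. \<Sum>i\<in>I. c i * meeting_weight p m n (x i) (y i))"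
  unfolding meeting_limit_def SUP_mult_left_ennreal
  by (intro ennreal_SUP_sum[symmetric])
    (auto simp: incseq_def intro!: mult_left_mono incseqD[OF incseq_meeting_weight])

lemma meeting_limit_left:
  assumes "x < y"
  shows "(\<Sum>j=1..p. m j * meeting_limit p m (x + int j) y) \<le> meeting_limit p m x y"
proof -
  have "(\<Sum>j=1..p. m j * meeting_weight p m n (x + int j) y) \<le> meeting_limit p m x y" for n
    unfolding meeting_limit_def using assms by (intro SUP_upper2[of "Suc n"]) auto
  then show ?thesis unfolding sum_mult_meeting_limit by (intro SUP_least)
qed

lemma meeting_limit_right:
  assumes "y < x"
  shows "(\<Sum>j=1..p. m j * meeting_limit p m x (y + int j)) \<le> meeting_limit p m x y"
proof -
  have "(\<Sum>j=1..p. m j * meeting_weight p m n x (y + int j)) \<le> meeting_limit p m x y" for n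
    unfolding meeting_limit_def using assms by (intro SUP_upper2[of "Suc n"]) auto
  then show ?thesis unfolding sum_mult_meeting_limit by (intro SUP_least)
qed

text \<open>The walker behind can catch up in a single step of length
  \<open>\<bar>x - y\<bar>\<close>. Positivity serves to transfer finiteness of the sum over closed
  pairs to the second moments.\<close>

lemma meeting_limit_pos:
  assumes m: "\<And>j. 1 \<le> j \<Longrightarrow> j \<le> p \<Longrightarrow> 0 < m j" and "\<bar>x - y\<bar> \<le> int p"
  shows "0 < meeting_limit p m x y"
proof -
  consider "x = y" | "x < y" | "y < x" by linarith
  then show ?thesis
  proof cases
    case 2
    then have "0 < m (nat (y - x)) * meeting_limit p m (x + int (nat (y - x))) y"
      using assms by (auto intro!: m)
    also have "\<dots> \<le> (\<Sum>j=1..p. m j * meeting_limit p m (x + int j) y)"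
      using 2 assms by (intro member_le_sum) auto
    also have "\<dots> \<le> meeting_limit p m x y" by (rule meeting_limit_left[OF 2])
    finally show ?thesis .
  next
    case 3
    then have "0 < m (nat (x - y)) * meeting_limit p m x (y + int (nat (x - y)))"
      using assms by (auto intro!: m)
    also have "\<dots> \<le> (\<Sum>j=1..p. m j * meeting_limit p m x (y + int j))"
      using 3 assms by (intro member_le_sum) auto
    also have "\<dots> \<le> meeting_limit p m x y" by (rule meeting_limit_right[OF 3])
    finally show ?thesis .
  qed simp
qed

section \<open>Expectations over closed pairs\<close>

text \<open>Meaningful only for \<open>u\<close> among the non-final terms of \<open>s\<close>.\<close>

definition step_from :: "int list \<Rightarrow> int \<Rightarrow> nat" where
  "step_from s u = (let i = the_inv_into {..<nsteps s} ((!) s) u in nat (s ! (i + 1) - s ! i))"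

text \<open>The times whose environment the path uses. No step starts at the final term, which is
  therefore left out.\<close>

definition step_times :: "int list \<Rightarrow> int set" where
  "step_times s = (!) s ` {..<nsteps s}"

lemma finite_step_times [simp]: "finite (step_times s)"
  by (simp add: step_times_def)

lemma inj_on_nth_sorted: "sorted_wrt (<) (s :: int list) \<Longrightarrow> inj_on ((!) s) {..<nsteps s}"
  by (auto simp: inj_on_def nsteps_def strict_sorted_iff nth_eq_iff_index_eq)

lemma step_from_nth:
  "sorted_wrt (<) s \<Longrightarrow> i < nsteps s \<Longrightarrow> step_from s (s ! i) = nat (s ! (i + 1) - s ! i)"
  by (simp add: step_from_def Let_def the_inv_into_f_f inj_on_nth_sorted)

lemma step_from_pos:
  assumes "sorted_wrt (<) s" "u \<in> step_times s"
  shows "1 \<le> step_from s u"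
proof -
  obtain i where i: "i < nsteps s" "u = s ! i" using assms by (auto simp: step_times_def)
  then have "s ! i < s ! (i + 1)"
    using sorted_wrt_nth_less[OF assms(1), of i "i + 1"] by (simp add: nsteps_def less_diff_conv)
  then show ?thesis using i step_from_nth[OF assms(1) i(1)] by simp
qed

text \<open>Independence holds across times, so products along a path are reindexed by the times at
  which its steps start.\<close>

lemma prod_step_times:
  assumes "sorted_wrt (<) s"
  shows "(\<Prod>u\<in>step_times s. f u (step_from s u)) = (\<Prod>i<nsteps s. f (s ! i) (nat (s ! (i + 1) - s ! i)))"
  unfolding step_times_def
  by (subst prod.reindex) (auto simp: inj_on_nth_sorted step_from_nth assms intro!: prod.cong)

lemma step_times_eq_set_butlast: "step_times s = set (butlast s)"
  using nth_image[of "length s - 1" s]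
  by (simp add: butlast_conv_take atLeast0LessThan step_times_def nsteps_def)

lemma step_from_Cons:
  assumes "sorted_wrt (<) (x # s)" "u \<in> step_times s"
  shows "step_from (x # s) u = step_from s u"
proof -
  obtain i where i: "i < nsteps s" "u = s ! i" using assms by (auto simp: step_times_def)
  then have "Suc i < nsteps (x # s)" by (simp add: nsteps_def)
  then show ?thesis
    using step_from_nth[OF assms(1), of "Suc i"] step_from_nth[of s i] assms i by simp
qed

context
  fixes M :: "'a measure" and N :: "'b measure"
    and A :: "nat \<Rightarrow> 'a \<Rightarrow> real" and X :: "int \<Rightarrow> nat \<Rightarrow> 'b \<Rightarrow> real"
  assumes N: "prob_space N"
    and A_meas: "\<And>j. j \<ge> 1 \<Longrightarrow> A j \<in> borel_measurable M"
    and A_nonneg: "\<And>j. j \<ge> 1 \<Longrightarrow> AE \<omega> in M. 0 \<le> A j \<omega>"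
    and iid: "iid_copies M A N X"
begin

lemma measurable_seq_rv: "seq_rv A \<in> measurable M seq_space"
  unfolding seq_rv_def seq_space_def by (intro measurable_restrict) (auto intro: A_meas)

lemma measurable_seq_rv_copy: "seq_rv (X t) \<in> measurable N seq_space"
proof -
  interpret N: prob_space N by fact
  show ?thesis using iid unfolding iid_copies_def N.indep_vars_def by simp
qed

lemma distr_seq_rv_copy: "distr N seq_space (seq_rv (X t)) = distr M seq_space (seq_rv A)"
  using iid by (simp add: iid_copies_def)

lemma measurable_component_seq_space [measurable]:
  "1 \<le> j \<Longrightarrow> (\<lambda>a. a j) \<in> borel_measurable seq_space"
  unfolding seq_space_def by (rule measurable_component_singleton) simp

lemma nn_integral_seq_rv_copy:
  assumes "h \<in> borel_measurable seq_space"
  shows "(\<integral>\<^sup>+\<omega>. h (seq_rv (X t) \<omega>) \<partial>N) = (\<integral>\<^sup>+\<omega>. h (seq_rv A \<omega>) \<partial>M)"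
  using nn_integral_distr[OF measurable_seq_rv_copy[of t], of h] nn_integral_distr[OF measurable_seq_rv, of h]
    assms by (simp add: distr_seq_rv_copy)

lemma AE_copy_nonneg:
  assumes "1 \<le> j"
  shows "AE \<omega> in N. 0 \<le> X t j \<omega>"
proof -
  have [measurable]: "(\<lambda>a. a j) \<in> borel_measurable seq_space" using assms by measurable
  have "{a \<in> space seq_space. 0 \<le> a j} \<in> sets seq_space" by measurable
  then have *: "(AE \<omega> in N. 0 \<le> seq_rv (X t) \<omega> j) \<longleftrightarrow> (AE \<omega> in M. 0 \<le> seq_rv A \<omega> j)"
    using AE_distr_iff[OF measurable_seq_rv_copy[of t], of "\<lambda>a. 0 \<le> a j"]
      AE_distr_iff[OF measurable_seq_rv, of "\<lambda>a. 0 \<le> a j"]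
    unfolding distr_seq_rv_copy by simp
  then show ?thesis using A_nonneg[OF assms] assms by (simp add: seq_rv_def)
qed

text \<open>Time 0 is the only time at which both paths start a step, so it contributes a joint
  second moment. All other times are used by exactly one of the paths, and independence turns their
  factors into first moments.\<close>

lemma nn_integral_closed_pair:
  assumes "(s, t) \<in> closed_pairs"
  defines "m \<equiv> \<lambda>j. \<integral>\<^sup>+\<omega>. ennreal (A j \<omega>) \<partial>M"
  shows "(\<integral>\<^sup>+\<omega>. ennreal (seq_prod X s \<omega> * seq_prod X t \<omega>) \<partial>N) =
    (\<integral>\<^sup>+\<omega>. ennreal (A (nat (s ! 1)) \<omega> * A (nat (t ! 1)) \<omega>) \<partial>M) *
      (path_weight m (tl s) * path_weight m (tl t))"
proof -
  interpret N: prob_space N by fact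
  obtain s' t' where st: "s = 0 # s'" "t = 0 # t'" "0 < hd s'" "0 < hd t'" "first_meeting s' t'"
    using assms(1) unfolding closed_pairs_iff by blast
  then have ne: "s' \<noteq> []" "t' \<noteq> []" and sorted': "sorted_wrt (<) s'" "sorted_wrt (<) t'"
    and disj: "step_times s' \<inter> step_times t' = {}"
    by (auto simp: first_meeting_def step_times_eq_set_butlast)
  have sorted: "sorted_wrt (<) s" "sorted_wrt (<) t"
    unfolding st(1,2) sorted_Cons_hd[OF ne(1)] sorted_Cons_hd[OF ne(2)] using st sorted' by auto
  have times: "step_times s = insert 0 (step_times s')" "step_times t = insert 0 (step_times t')"
    using ne st by (auto simp: step_times_eq_set_butlast)
  have "0 \<notin> set s'" "0 \<notin> set t'" using sorted st by auto
  then have zero: "0 \<notin> step_times s'" "0 \<notin> step_times t'"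
    by (auto simp: step_times_eq_set_butlast dest: in_set_butlastD)
  have zero_step: "step_from s 0 = nat (s ! 1)" "step_from t 0 = nat (t ! 1)"
    using step_from_nth[OF sorted(1), of 0] step_from_nth[OF sorted(2), of 0] ne st
    by (auto simp: nsteps_def)
  define U where "U = step_times s \<union> step_times t"
  \<comment> \<open>The joint contribution of both paths at time \<open>u\<close>, with the factor 1
    for a path that starts no step there.\<close>
  define g where "g u a = (if u \<in> step_times s then ennreal (a (step_from s u)) else 1) *
    (if u \<in> step_times t then ennreal (a (step_from t u)) else 1)" for u and a :: "nat \<Rightarrow> real"
  have g_meas [measurable]: "g u \<in> borel_measurable seq_space" for u
  proof -
    have [measurable]: "u \<in> step_times s \<Longrightarrow> (\<lambda>a. a (step_from s u)) \<in> borel_measurable seq_space"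
      "u \<in> step_times t \<Longrightarrow> (\<lambda>a. a (step_from t u)) \<in> borel_measurable seq_space"
      using step_from_pos[OF sorted(1)] step_from_pos[OF sorted(2)]
      by (auto intro!: measurable_component_seq_space)
    show ?thesis unfolding g_def by (cases "u \<in> step_times s"; cases "u \<in> step_times t") simp_all
  qed
  have AE_nonneg: "AE \<omega> in N. \<forall>u\<in>step_times r. 0 \<le> X (- u) (step_from r u) \<omega>"
    if "sorted_wrt (<) r" for r
    using step_from_pos[OF that] by (intro AE_finite_allI AE_copy_nonneg) auto
  have "AE \<omega> in N. ennreal (seq_prod X s \<omega> * seq_prod X t \<omega>) = (\<Prod>u\<in>U. g u (seq_rv (X (- u)) \<omega>))"
    using AE_nonneg[OF sorted(1)] AE_nonneg[OF sorted(2)]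
  proof eventually_elim
    case (elim \<omega>)
    have seq_prod: "ennreal (seq_prod X r \<omega>) =
        (\<Prod>u\<in>U. if u \<in> step_times r then ennreal (seq_rv (X (- u)) \<omega> (step_from r u)) else 1)"
      "0 \<le> seq_prod X r \<omega>"
      if "sorted_wrt (<) r" "step_times r \<subseteq> U" "\<forall>u\<in>step_times r. 0 \<le> X (- u) (step_from r u) \<omega>" for r
    proof -
      have *: "seq_prod X r \<omega> = (\<Prod>u\<in>step_times r. X (- u) (step_from r u) \<omega>)"
        unfolding seq_prod_def Atilde_def
        by (rule prod_step_times[OF that(1), of "\<lambda>u j. X (- u) j \<omega>", symmetric])
      then show "0 \<le> seq_prod X r \<omega>" using that by (auto intro: prod_nonneg)
      have "ennreal (seq_prod X r \<omega>) = (\<Prod>u\<in>step_times r. ennreal (X (- u) (step_from r u) \<omega>))"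
        unfolding * using that by (intro prod_ennreal[symmetric]) auto
      also have "\<dots> = (\<Prod>u\<in>step_times r. ennreal (seq_rv (X (- u)) \<omega> (step_from r u)))"
        using step_from_pos[OF that(1)] by (intro prod.cong) (auto simp: seq_rv_def)
      also have "\<dots> = (\<Prod>u\<in>U. if u \<in> step_times r then ennreal (seq_rv (X (- u)) \<omega> (step_from r u)) else 1)"
        using that by (intro prod.mono_neutral_cong_left) (auto simp: U_def)
      finally show "ennreal (seq_prod X r \<omega>) = \<dots>" .
    qed
    show ?case
      unfolding g_def prod.distrib
      using seq_prod[OF sorted(1)] seq_prod[OF sorted(2)] elim by (simp add: U_def ennreal_mult)
  qed
  then have "(\<integral>\<^sup>+\<omega>. ennreal (seq_prod X s \<omega> * seq_prod X t \<omega>) \<partial>N) =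
      (\<integral>\<^sup>+\<omega>. (\<Prod>u\<in>U. g u (seq_rv (X (- u)) \<omega>)) \<partial>N)"
    by (rule nn_integral_cong_AE)
  \<comment> \<open>\<open>Atilde\<close> reverses time, so the environment at path time
    \<open>u\<close> is the copy with index \<open>- u\<close>.\<close>
  also have "\<dots> = (\<integral>\<^sup>+\<omega>. (\<Prod>v\<in>uminus ` U. g (- v) (seq_rv (X v) \<omega>)) \<partial>N)"
    by (subst prod.reindex) (auto simp: inj_on_def)
  also have "\<dots> = (\<Prod>v\<in>uminus ` U. \<integral>\<^sup>+\<omega>. g (- v) (seq_rv (X v) \<omega>) \<partial>N)"
  proof (rule N.indep_vars_nn_integral)
    have "N.indep_vars (\<lambda>_. seq_space) (\<lambda>t. seq_rv (X t)) (uminus ` U)"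
      using iid N.indep_vars_subset unfolding iid_copies_def by blast
    then show "N.indep_vars (\<lambda>_. borel) (\<lambda>v \<omega>. g (- v) (seq_rv (X v) \<omega>)) (uminus ` U)"
      by (rule N.indep_vars_compose2) measurable
  qed (auto simp: U_def)
  also have "\<dots> = (\<Prod>u\<in>U. \<integral>\<^sup>+\<omega>. g u (seq_rv A \<omega>) \<partial>M)"
    by (subst prod.reindex) (auto simp: inj_on_def nn_integral_seq_rv_copy[OF g_meas])
  also have "U = insert 0 (step_times s' \<union> step_times t')"
    by (auto simp: U_def times)
  also have "(\<Prod>u\<in>\<dots>. \<integral>\<^sup>+\<omega>. g u (seq_rv A \<omega>) \<partial>M) =
      (\<integral>\<^sup>+\<omega>. g 0 (seq_rv A \<omega>) \<partial>M) *
      ((\<Prod>u\<in>step_times s'. \<integral>\<^sup>+\<omega>. g u (seq_rv A \<omega>) \<partial>M) * (\<Prod>u\<in>step_times t'. \<integral>\<^sup>+\<omega>. g u (seq_rv A \<omega>) \<partial>M))"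
    using zero disj by (simp add: prod.union_disjoint)
  also have "(\<integral>\<^sup>+\<omega>. g 0 (seq_rv A \<omega>) \<partial>M) = (\<integral>\<^sup>+\<omega>. ennreal (A (nat (s ! 1)) \<omega> * A (nat (t ! 1)) \<omega>) \<partial>M)"
  proof (rule nn_integral_cong_AE)
    have pos: "1 \<le> nat (s ! 1)" "1 \<le> nat (t ! 1)"
      using step_from_pos[OF sorted(1), of 0] step_from_pos[OF sorted(2), of 0] times zero_step by auto
    show "AE \<omega> in M. g 0 (seq_rv A \<omega>) = ennreal (A (nat (s ! 1)) \<omega> * A (nat (t ! 1)) \<omega>)"
      using A_nonneg[OF pos(1)] A_nonneg[OF pos(2)]
    proof eventually_elim
      case (elim \<omega>)
      then show ?case using pos
        unfolding g_def times zero_step by (simp add: seq_rv_def ennreal_mult)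
    qed
  qed
  also have "(\<Prod>u\<in>step_times s'. \<integral>\<^sup>+\<omega>. g u (seq_rv A \<omega>) \<partial>M) = (\<Prod>u\<in>step_times s'. m (step_from s' u))"
  proof (rule prod.cong[OF refl])
    fix u assume u: "u \<in> step_times s'"
    then have "u \<in> step_times s" "u \<notin> step_times t" "step_from s u = step_from s' u"
      using disj zero times step_from_Cons[OF sorted(1)[unfolded st] u] st by auto
    then show "(\<integral>\<^sup>+\<omega>. g u (seq_rv A \<omega>) \<partial>M) = m (step_from s' u)"
      using step_from_pos[OF sorted'(1) u] by (simp add: g_def m_def seq_rv_def)
  qed
  also have "\<dots> = path_weight m s'"
    unfolding path_weight_def by (rule prod_step_times[OF sorted'(1)])
  also have "(\<Prod>u\<in>step_times t'. \<integral>\<^sup>+\<omega>. g u (seq_rv A \<omega>) \<partial>M) = (\<Prod>u\<in>step_times t'. m (step_from t' u))"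
  proof (rule prod.cong[OF refl])
    fix u assume u: "u \<in> step_times t'"
    then have "u \<in> step_times t" "u \<notin> step_times s" "step_from t u = step_from t' u"
      using disj zero times step_from_Cons[OF sorted(2)[unfolded st] u] st by auto
    then show "(\<integral>\<^sup>+\<omega>. g u (seq_rv A \<omega>) \<partial>M) = m (step_from t' u)"
      using step_from_pos[OF sorted'(2) u] by (simp add: g_def m_def seq_rv_def)
  qed
  also have "\<dots> = path_weight m t'"
    unfolding path_weight_def by (rule prod_step_times[OF sorted'(2)])
  finally show ?thesis by (simp add: st)
qed

end

section \<open>The operator of second moments\<close>

text \<open>The row index \<open>i * p + k\<close> of the Kronecker product is read as the pair of the remaining waiting
  times \<open>i\<close> and \<open>k\<close> of two walkers; each walker at waiting time 0 draws a new step.\<close>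

definition second_moment_entry ::
  "(nat \<Rightarrow> 'c) \<Rightarrow> (nat \<Rightarrow> nat \<Rightarrow> 'c) \<Rightarrow> nat \<Rightarrow> nat \<Rightarrow> nat \<Rightarrow> nat \<Rightarrow> 'c::zero_neq_one" where
  "second_moment_entry m S i k j l =
     (case (i, k) of
        (0, 0) \<Rightarrow> S (Suc j) (Suc l)
      | (0, Suc k') \<Rightarrow> if l = k' then m (Suc j) else 0
      | (Suc i', 0) \<Rightarrow> if j = i' then m (Suc l) else 0
      | (Suc i', Suc k') \<Rightarrow> if j = i' \<and> l = k' then 1 else 0)"

text \<open>The action of the matrix with entries \<open>second_moment_entry\<close> on a function
  of two waiting times, with the sums against zero and unit entries already evaluated.\<close>

definition second_moment_op ::
  "nat \<Rightarrow> (nat \<Rightarrow> real) \<Rightarrow> (nat \<Rightarrow> nat \<Rightarrow> real) \<Rightarrow> (nat \<Rightarrow> nat \<Rightarrow> real) \<Rightarrow> nat \<Rightarrow> nat \<Rightarrow> real" where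
  "second_moment_op p m S G i k =
     (case (i, k) of
        (0, 0) \<Rightarrow> \<Sum>j<p. \<Sum>l<p. S (Suc j) (Suc l) * G j l
      | (0, Suc k') \<Rightarrow> \<Sum>j<p. m (Suc j) * G j k'
      | (Suc i', 0) \<Rightarrow> \<Sum>l<p. m (Suc l) * G i' l
      | (Suc i', Suc k') \<Rightarrow> G i' k')"

lemma sum_second_moment_entry:
  assumes "i < p" "k < p"
  shows "(\<Sum>j<p. \<Sum>l<p. second_moment_entry m S i k j l * G j l) = second_moment_op p m S G i k"
proof -
  have *: "(\<Sum>l<p. (if l = b then c else 0) * f l) = (if b < p then c * f b else 0)" for b c and f :: "nat \<Rightarrow> real"
    by (simp add: if_distrib[of "\<lambda>x. x * _"] cong: if_cong)
  have **: "(\<Sum>j<p. \<Sum>l<p. (if j = a then f l else 0) * G j l) = (if a < p then \<Sum>l<p. f l * G a l else 0)"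
    for a f
    by (subst sum.swap) (simp add: *)
  have "(\<Sum>j<p. \<Sum>l<p. (if j = a \<and> l = b then 1 else 0) * G j l) = (if a < p \<and> b < p then G a b else 0)"
    for a b
  proof -
    have "(\<Sum>j<p. \<Sum>l<p. (if j = a \<and> l = b then 1 else 0) * G j l) =
        (\<Sum>j<p. \<Sum>l<p. (if j = a then if l = b then 1 else 0 else 0) * G j l)"
      by (intro sum.cong) auto
    then show ?thesis unfolding ** * by simp
  qed
  then show ?thesis
    using assms * ** by (auto simp: second_moment_entry_def second_moment_op_def split: nat.splits)
qed

lemma sum_lessThan_square: "(\<Sum>a<p * p. f a) = (\<Sum>j<p. \<Sum>l<p. f (j * p + l))" for f :: "nat \<Rightarrow> real"
proof -
  have "(\<Sum>l<p. f (j * p + l)) = sum f {j * p..<j * p + p}" for j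
    using sum.shift_bounds_nat_ivl[of f 0 "j * p" p] by (simp add: atLeast0LessThan add.commute)
  then show ?thesis by (simp add: sum.nat_group)
qed

lemma index_less_square: "i < p \<Longrightarrow> k < p \<Longrightarrow> i * p + k < p * (p :: nat)"
  by (metis (no_types, lifting) add.commute less_le_trans mult_le_mono1 mult_Suc nat_add_left_cancel_less Suc_leI)

text \<open>The two supersolution criteria for matrices, carried over from a single index to pairs
  by a = i * p + k.\<close>

lemma spectral_radius_second_moment:
  fixes R :: "real mat"
  assumes p: "p \<ge> 1" and R: "R \<in> carrier_mat (p * p) (p * p)"
    and entry: "\<And>i k j l. i < p \<Longrightarrow> k < p \<Longrightarrow> j < p \<Longrightarrow> l < p \<Longrightarrow>
      R $$ (i * p + k, j * p + l) = second_moment_entry m S i k j l"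
    and m: "\<And>j. 0 \<le> m j" and S: "\<And>j l. 0 \<le> S j l"
  shows "spectral_radius (map_mat complex_of_real R) < 1 \<longleftrightarrow>
    (\<exists>G. \<forall>i<p. \<forall>k<p. 0 < G i k \<and> second_moment_op p m S G i k < G i k)"
proof -
  have split: "a div p < p" "a mod p < p" "a div p * p + a mod p = a" if "a < p * p" for a
    using p that by (auto simp: less_mult_imp_div_less)
  have nonneg: "0 \<le> R $$ (a, b)" if "a < p * p" "b < p * p" for a b
  proof -
    have "R $$ (a, b) = second_moment_entry m S (a div p) (a mod p) (b div p) (b mod p)"
      using entry[of "a div p" "a mod p" "b div p" "b mod p"] split[OF that(1)] split[OF that(2)] by simp
    then show ?thesis using m S by (auto simp: second_moment_entry_def split: nat.splits)
  qed
  have row: "(\<Sum>b<p * p. R $$ (i * p + k, b) * g b) = second_moment_op p m S (\<lambda>j l. g (j * p + l)) i k"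
    if "i < p" "k < p" for i k g
  proof -
    have "(\<Sum>b<p * p. R $$ (i * p + k, b) * g b) =
        (\<Sum>j<p. \<Sum>l<p. second_moment_entry m S i k j l * g (j * p + l))"
      unfolding sum_lessThan_square using that by (intro sum.cong refl) (simp add: entry)
    then show ?thesis using sum_second_moment_entry[OF that] by simp
  qed
  show ?thesis
  proof
    assume "spectral_radius (map_mat complex_of_real R) < 1"
    then obtain g where g: "\<And>a. a < p * p \<Longrightarrow> 0 < g a"
      "\<And>a. a < p * p \<Longrightarrow> (\<Sum>b<p * p. R $$ (a, b) * g b) < g a"
      using spectral_radius_less_1_imp_supersolution[OF R _ nonneg] p by auto
    show "\<exists>G. \<forall>i<p. \<forall>k<p. 0 < G i k \<and> second_moment_op p m S G i k < G i k"
    proof (intro exI allI impI)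
      fix i k assume ik: "i < p" "k < p"
      show "0 < g (i * p + k) \<and> second_moment_op p m S (\<lambda>j l. g (j * p + l)) i k < g (i * p + k)"
        using g[OF index_less_square[OF ik]] row[OF ik, of g] by simp
    qed
  next
    assume "\<exists>G. \<forall>i<p. \<forall>k<p. 0 < G i k \<and> second_moment_op p m S G i k < G i k"
    then obtain G where G: "\<And>i k. i < p \<Longrightarrow> k < p \<Longrightarrow> 0 < G i k"
      "\<And>i k. i < p \<Longrightarrow> k < p \<Longrightarrow> second_moment_op p m S G i k < G i k" by blast
    define g where "g = (\<lambda>a. G (a div p) (a mod p))"
    have op_cong: "second_moment_op p m S (\<lambda>j l. g (j * p + l)) i k = second_moment_op p m S G i k"
      if "i < p" "k < p" for i k
      unfolding sum_second_moment_entry[OF that, symmetric] g_def by (intro sum.cong) auto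
    show "spectral_radius (map_mat complex_of_real R) < 1"
    proof (rule supersolution_imp_spectral_radius_less_1[OF R _ nonneg])
      fix a assume a: "a < p * p"
      show "0 < g a" using G(1) split[OF a] by (simp add: g_def)
      show "(\<Sum>b<p * p. R $$ (a, b) * g b) < g a"
        using row[OF split(1,2)[OF a], of g] op_cong[OF split(1,2)[OF a]] G(2)[OF split(1,2)[OF a]]
        unfolding split(3)[OF a] by (simp add: g_def)
    qed (use p in auto)
  qed
qed

text \<open>The weights \<open>1 + \<delta> (i + k)\<close> decrease strictly along the transitions out of every state
  other than (0, 0).\<close>

lemma linear_supersolution:
  fixes m :: "nat \<Rightarrow> real"
  assumes m: "\<And>j. 0 \<le> m j" and less: "(\<Sum>j<p. m (Suc j)) < 1" and p: "p \<ge> 1"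
  shows "\<exists>H. (\<forall>i k. 1 \<le> H i k) \<and> (\<forall>i k. H i k < H (Suc i) (Suc k)) \<and>
    (\<forall>k<p. (\<Sum>j<p. m (Suc j) * H j k) < H 0 (Suc k)) \<and>
    (\<forall>i<p. (\<Sum>l<p. m (Suc l) * H i l) < H (Suc i) (0 :: nat))"
proof -
  define s where "s = (\<Sum>j<p. m (Suc j))"
  have s: "0 \<le> s" "s < 1" using m less by (auto simp: s_def sum_nonneg)
  \<comment> \<open>For indices below \<open>p\<close> this makes \<open>\<delta> * (j + k)\<close>
    at most (1 - s) / 2, so the weighted sums of \<open>H\<close> stay below 1 while
    \<open>H\<close> itself is at least 1.\<close>
  define \<delta> where "\<delta> = (1 - s) / (4 * p)"
  have \<delta>: "0 < \<delta>" using s p by (simp add: \<delta>_def)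
  define H :: "nat \<Rightarrow> nat \<Rightarrow> real" where "H i k = 1 + \<delta> * (i + k)" for i k
  have H: "1 \<le> H i k" "H i k < H (Suc i) (Suc k)" for i k
    using \<delta> by (auto simp: H_def algebra_simps)
  have H_sum: "(\<Sum>j<p. m (Suc j) * H j k) < 1" if "k < p" for k
  proof -
    have "H j k \<le> 1 + \<delta> * (2 * p)" if "j < p" for j
      unfolding H_def using that \<open>k < p\<close> \<delta> by (intro add_left_mono mult_left_mono) auto
    then have "(\<Sum>j<p. m (Suc j) * H j k) \<le> (\<Sum>j<p. m (Suc j) * (1 + \<delta> * (2 * p)))"
      using m by (intro sum_mono mult_left_mono) auto
    also have "\<dots> = s * (1 + \<delta> * (2 * p))"
      by (simp add: s_def sum_distrib_right)
    also have "\<delta> * (2 * p) = (1 - s) / 2"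
      using p by (simp add: \<delta>_def)
    also have "s * (1 + (1 - s) / 2) = s + s * (1 - s) / 2"
      by (simp add: algebra_simps)
    also have "\<dots> < 1"
    proof -
      \<comment> \<open>Expanded, this is the inequality s + s (1 - s) / 2 < 1.\<close>
      have "0 < (1 - s) * (2 - s)" using s by simp
      then show ?thesis by (simp add: field_simps)
    qed
    finally show ?thesis .
  qed
  have "H i k = H k i" for i k by (simp add: H_def)
  then have H_sum': "(\<Sum>l<p. m (Suc l) * H i l) < 1" if "i < p" for i
    using H_sum[OF that] by simp
  show ?thesis
    using less_le_trans[OF H_sum H(1)] less_le_trans[OF H_sum' H(1)] H
    by (intro exI[of _ H] conjI allI impI) simp_all
qed

text \<open>\<open>F\<close> has slack only at (0, 0), while \<open>H\<close> has slack everywhere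
  else. A small multiple of \<open>H\<close> added to \<open>F\<close> is strict everywhere if the
  slack of \<open>F\<close> at (0, 0) absorbs what \<open>H\<close> adds there.\<close>

lemma strict_supersolution_exists:
  fixes m :: "nat \<Rightarrow> real"
  assumes m: "\<And>j. 0 \<le> m j" and S: "\<And>j l. 0 \<le> S j l"
    and less: "(\<Sum>j<p. m (Suc j)) < 1" and p: "p \<ge> 1"
    and F: "\<And>i k. 0 \<le> F i k" "F 0 0 = 1"
    and F_le: "\<And>i k. i < p \<Longrightarrow> k < p \<Longrightarrow> (i, k) \<noteq> (0, 0) \<Longrightarrow> second_moment_op p m S F i k \<le> F i k"
    and F_less: "second_moment_op p m S F 0 0 < 1"
  shows "\<exists>G. \<forall>i<p. \<forall>k<p. 0 < G i k \<and> second_moment_op p m S G i k < G i k"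
proof -
  obtain H where H: "\<And>i k. 1 \<le> H i k" "\<And>i k. H i k < H (Suc i) (Suc k)"
    "\<And>k. k < p \<Longrightarrow> (\<Sum>j<p. m (Suc j) * H j k) < H 0 (Suc k)"
    "\<And>i. i < p \<Longrightarrow> (\<Sum>l<p. m (Suc l) * H i l) < H (Suc i) (0 :: nat)"
    using linear_supersolution[OF m less p] by blast
  define K where "K = second_moment_op p m S H 0 0"
  have "0 \<le> H i k" for i k using H(1)[of i k] by linarith
  then have K: "0 \<le> K" unfolding K_def second_moment_op_def using S by (auto intro!: sum_nonneg)
  \<comment> \<open>\<open>\<epsilon> * (K + 1)\<close> is exactly the slack of \<open>F\<close> at
    (0, 0), so the value of the operator on \<open>G\<close> there is 1 - \<open>\<epsilon>\<close>.
    The summand 1 keeps the denominator positive.\<close>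
  define \<epsilon> where "\<epsilon> = (1 - second_moment_op p m S F 0 0) / (K + 1)"
  have \<epsilon>: "0 < \<epsilon>" using K F_less by (simp add: \<epsilon>_def)
  have \<epsilon>K: "second_moment_op p m S F 0 0 + \<epsilon> * K < 1 + \<epsilon>"
  proof -
    have "\<epsilon> * (K + 1) = 1 - second_moment_op p m S F 0 0" using K by (simp add: \<epsilon>_def)
    then show ?thesis using \<epsilon> by (simp add: algebra_simps)
  qed
  define G where "G i k = F i k + \<epsilon> * H i k" for i k
  have op_G: "second_moment_op p m S G i k = second_moment_op p m S F i k + \<epsilon> * second_moment_op p m S H i k" for i k
    unfolding second_moment_op_def G_def
    by (auto simp: sum.distrib sum_distrib_left algebra_simps split: nat.splits)
  have op_H: "second_moment_op p m S H i k < H i k" if "i < p" "k < p" "(i, k) \<noteq> (0, 0)" for i k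
    using H(2-4) that by (auto simp: second_moment_op_def split: nat.splits)
  have "0 < G i k \<and> second_moment_op p m S G i k < G i k" if ik: "i < p" "k < p" for i k
  proof
    show "0 < G i k"
      unfolding G_def using F(1)[of i k] \<epsilon> H(1)[of i k] by (intro add_nonneg_pos mult_pos_pos) linarith+
    show "second_moment_op p m S G i k < G i k"
    proof (cases "(i, k) = (0, 0)")
      case True
      have "\<epsilon> \<le> \<epsilon> * H 0 0" using \<epsilon> H(1)[of 0 0] by simp
      then show ?thesis using \<epsilon>K F(2) True unfolding op_G by (simp add: G_def K_def)
    next
      case False
      have "\<epsilon> * second_moment_op p m S H i k < \<epsilon> * H i k"
        using op_H[OF ik False] \<epsilon> by simp
      then show ?thesis using F_le[OF ik False] unfolding op_G G_def by linarith
    qed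
  qed
  then show ?thesis by blast
qed

text \<open>If the means add up to at least 1, then the constant function 1 is a subsolution, which is
  incompatible with a strict supersolution where the latter is minimal.\<close>

lemma strict_supersolution_imp_mean_less_1:
  fixes m :: "nat \<Rightarrow> real"
  assumes m: "\<And>j. 0 \<le> m j" and S: "\<And>j l. 0 \<le> S j l" and p: "p \<ge> 1"
    and var: "2 * (\<Sum>j<p. m (Suc j)) \<le> (\<Sum>j<p. \<Sum>l<p. S (Suc j) (Suc l)) + 1"
    and G: "\<And>i k. i < p \<Longrightarrow> k < p \<Longrightarrow> 0 < G i k"
      "\<And>i k. i < p \<Longrightarrow> k < p \<Longrightarrow> second_moment_op p m S G i k < G i k"
  shows "(\<Sum>j<p. m (Suc j)) < 1"
proof (rule ccontr)
  assume "\<not> ?thesis"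
  then have ge: "1 \<le> (\<Sum>j<p. m (Suc j))" "1 \<le> (\<Sum>j<p. \<Sum>l<p. S (Suc j) (Suc l))"
    using var by linarith+
  define c where "c = Min ((\<lambda>(i, k). G i k) ` ({..<p} \<times> {..<p}))"
  have le: "c \<le> G i k" if "i < p" "k < p" for i k
    unfolding c_def using that by (intro Min_le) auto
  have "c \<in> (\<lambda>(i, k). G i k) ` ({..<p} \<times> {..<p})"
    unfolding c_def using p by (intro Min_in) (auto simp: lessThan_empty_iff)
  then obtain i k where ik: "i < p" "k < p" "c = G i k" by auto
  have c: "0 < c" using G(1) ik by simp
  \<comment> \<open>Replacing \<open>G\<close> by its minimum \<open>c\<close> only lowers the
    operator, and its rows add up to at least 1, so the operator is at least \<open>c\<close> also
    where \<open>G\<close> attains \<open>c\<close>.\<close>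
  have "(\<Sum>j<p. m (Suc j) * c) \<le> (\<Sum>j<p. m (Suc j) * G j b)"
    "(\<Sum>j<p. m (Suc j) * c) \<le> (\<Sum>j<p. m (Suc j) * G b j)" if "b < p" for b
    using that m by (auto intro!: sum_mono mult_left_mono le)
  moreover have "(\<Sum>j<p. \<Sum>l<p. S (Suc j) (Suc l) * c) \<le> (\<Sum>j<p. \<Sum>l<p. S (Suc j) (Suc l) * G j l)"
    using S by (auto intro!: sum_mono mult_left_mono le)
  moreover have "c \<le> (\<Sum>j<p. m (Suc j) * c)" "c \<le> (\<Sum>j<p. \<Sum>l<p. S (Suc j) (Suc l) * c)"
    using ge c unfolding sum_distrib_right[symmetric] by simp_all
  ultimately have "c \<le> second_moment_op p m S G i k"
    using ik(1,2) le unfolding second_moment_op_def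
    by (auto split: nat.splits intro: order.trans)
  then show False using G(2)[OF ik(1,2)] ik(3) by simp
qed

section \<open>Linking the expectation matrix, the meeting weights and the operator\<close>

lemma nn_expectation_kronecker_companion:
  assumes "prob_space M" and ik: "i < p" "k < p" and jl: "j < p" "l < p"
  shows "nn_expectation_mat M (p * p) (p * p)
      (\<lambda>\<omega>. kronecker_prod (companion p (\<lambda>j. A j \<omega>)) (companion p (\<lambda>j. A j \<omega>))) $$ (i * p + k, j * p + l) =
    second_moment_entry (\<lambda>j. \<integral>\<^sup>+\<omega>. ennreal (A j \<omega>) \<partial>M) (\<lambda>j l. \<integral>\<^sup>+\<omega>. ennreal (A j \<omega> * A l \<omega>) \<partial>M) i k j l"
proof -
  interpret prob_space M by fact
  note less = index_less_square[OF ik] index_less_square[OF jl]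
  have comp: "companion p a $$ (i, j) = (if i = 0 then a (Suc j) else if i = Suc j then 1 else 0)"
    if "i < p" "j < p" for i j a
    using that by (simp add: companion_def)
  have dim: "dim_row (companion p a) = p" "dim_col (companion p a) = p" for a
    by (simp_all add: companion_def)
  have kron: "kronecker_prod (companion p a) (companion p a) $$ (i * p + k, j * p + l) =
      companion p a $$ (i, j) * companion p a $$ (k, l)" for a
    using ik jl less by (simp add: kronecker_prod_def dim)
  show ?thesis
    unfolding nn_expectation_mat_def index_mat(1)[OF less] prod.case kron comp[OF ik(1) jl(1)] comp[OF ik(2) jl(2)]
    by (auto simp: second_moment_entry_def emeasure_space_1 split: nat.splits)
qed

text \<open>Applied twice: to the linear weights \<open>H\<close>, to show that the meeting weights
  are finite, and to a normalised strict supersolution, to bound the sum over closed pairs.\<close>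

lemma meeting_limit_0_le:
  fixes m G :: "_ \<Rightarrow> _"
  assumes "p \<ge> 1" and m: "\<And>j. 0 \<le> m j" and G0: "\<And>i k. i < p \<Longrightarrow> k < p \<Longrightarrow> 0 \<le> G i k" and "1 \<le> G 0 0"
    and G: "\<And>i k. i < p \<Longrightarrow> k < p \<Longrightarrow> (i, k) \<noteq> (0, 0) \<Longrightarrow> second_moment_op p m S G i k \<le> G i k"
    and "i < p" "k < p"
  shows "meeting_limit p (\<lambda>j. ennreal (m j)) (int i) (int k) \<le> ennreal (G i k)"
  unfolding meeting_limit_def
proof (intro SUP_least meeting_weight_le_supersolution)
  show "1 \<le> ennreal (G 0 0)" using assms by simp
next
  fix i k assume "Suc i < p" "Suc k < p"
  then show "ennreal (G i k) \<le> ennreal (G (Suc i) (Suc k))"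
    using G[of "Suc i" "Suc k"] by (intro ennreal_leI) (simp add: second_moment_op_def)
next
  fix k assume k: "Suc k < p"
  have "(\<Sum>j<p. ennreal (m (Suc j)) * ennreal (G j k)) = ennreal (\<Sum>j<p. m (Suc j) * G j k)"
    using k m G0 by (subst sum_ennreal[symmetric]) (auto simp: ennreal_mult)
  also have "\<dots> \<le> ennreal (G 0 (Suc k))"
    using G[of 0 "Suc k"] k by (intro ennreal_leI) (simp add: second_moment_op_def)
  finally show "(\<Sum>j<p. ennreal (m (Suc j)) * ennreal (G j k)) \<le> ennreal (G 0 (Suc k))" .
next
  fix i assume i: "Suc i < p"
  have "(\<Sum>l<p. ennreal (m (Suc l)) * ennreal (G i l)) = ennreal (\<Sum>l<p. m (Suc l) * G i l)"
    using i m G0 by (subst sum_ennreal[symmetric]) (auto simp: ennreal_mult)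
  also have "\<dots> \<le> ennreal (G (Suc i) 0)"
    using G[of "Suc i" 0] i by (intro ennreal_leI) (simp add: second_moment_op_def)
  finally show "(\<Sum>l<p. ennreal (m (Suc l)) * ennreal (G i l)) \<le> ennreal (G (Suc i) 0)" .
qed (use assms in auto)

text \<open>If one walker is at 0, this is the first-step inequality for meetings, translated by 1
  because a step \<open>Suc j\<close> leaves waiting time \<open>j\<close> one time unit later. If
  both wait, translation invariance gives equality.\<close>

lemma meeting_limit_supersolution:
  assumes m: "\<And>j. 0 \<le> m j" and F0: "\<And>i k. 0 \<le> F i k"
    and F: "\<And>i k. i < p \<Longrightarrow> k < p \<Longrightarrow> meeting_limit p (\<lambda>j. ennreal (m j)) (int i) (int k) = ennreal (F i k)"
    and ik: "i < p" "k < p" "(i, k) \<noteq> (0, 0)"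
  shows "second_moment_op p m S F i k \<le> F i k"
proof -
  let ?F = "meeting_limit p (\<lambda>j. ennreal (m j))"
  consider (left) k' where "i = 0" "k = Suc k'" | (right) i' where "i = Suc i'" "k = 0"
    | (both) i' k' where "i = Suc i'" "k = Suc k'"
    using ik by (cases i; cases k) auto
  then show ?thesis
  proof cases
    case left
    have "ennreal (\<Sum>j<p. m (Suc j) * F j k') = (\<Sum>j<p. ennreal (m (Suc j)) * ?F (int j + 1) (int k' + 1))"
      using left ik m F0 by (subst sum_ennreal[symmetric]) (auto simp: ennreal_mult F meeting_limit_translate)
    also have "\<dots> = (\<Sum>j=1..p. ennreal (m j) * ?F (0 + int j) (int k))"
      using left by (simp add: sum.atLeast1_atMost_eq add_ac)
    also have "\<dots> \<le> ?F (int i) (int k)" using meeting_limit_left[of 0 "int k"] left by simp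
    also have "\<dots> = ennreal (F i k)" using F ik by simp
    finally show ?thesis using left F0 by (simp add: second_moment_op_def)
  next
    case right
    have "ennreal (\<Sum>j<p. m (Suc j) * F i' j) = (\<Sum>j<p. ennreal (m (Suc j)) * ?F (int i' + 1) (int j + 1))"
      using right ik m F0 by (subst sum_ennreal[symmetric]) (auto simp: ennreal_mult F meeting_limit_translate)
    also have "\<dots> = (\<Sum>j=1..p. ennreal (m j) * ?F (int i) (0 + int j))"
      using right by (simp add: sum.atLeast1_atMost_eq add_ac)
    also have "\<dots> \<le> ?F (int i) (int k)" using meeting_limit_right[of 0 "int i"] right by simp
    also have "\<dots> = ennreal (F i k)" using F ik by simp
    finally show ?thesis using right F0 by (simp add: second_moment_op_def)
  next
    case both
    have "ennreal (F i' k') = ennreal (F i k)"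
      using F[of i' k'] F[OF ik(1,2)] ik both meeting_limit_translate[of p _ "int i'" 1 "int k'"]
      by (simp add: add.commute)
    then show ?thesis using F0 both by (simp add: second_moment_op_def)
  qed
qed

text \<open>The sum over closed pairs, split at the joint first step, is the value of the operator
  on the first passage weights at (0, 0), that is, the weight of first returns.\<close>

lemma sum_mult_meeting_limit_0_0:
  assumes "\<And>j l. 0 \<le> S j l" and "\<And>i k. 0 \<le> F i k"
    and F: "\<And>i k. i < p \<Longrightarrow> k < p \<Longrightarrow> meeting_limit p m (int i) (int k) = ennreal (F i k)"
  shows "(\<Sum>j=1..p. \<Sum>l=1..p. ennreal (S j l) * meeting_limit p m (int j) (int l)) =
    ennreal (second_moment_op p \<mu> S F 0 0)"
proof -
  have "(\<Sum>j=1..p. \<Sum>l=1..p. ennreal (S j l) * meeting_limit p m (int j) (int l)) =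
      (\<Sum>j<p. \<Sum>l<p. ennreal (S (Suc j) (Suc l)) * meeting_limit p m (int j + 1) (int l + 1))"
    by (simp add: sum.atLeast1_atMost_eq add_ac)
  also have "\<dots> = (\<Sum>j<p. \<Sum>l<p. ennreal (S (Suc j) (Suc l) * F j l))"
    unfolding meeting_limit_translate using assms by (intro sum.cong) (auto simp: ennreal_mult)
  also have "\<dots> = ennreal (second_moment_op p \<mu> S F 0 0)"
    using assms by (simp add: second_moment_op_def sum_ennreal sum_nonneg)
  finally show ?thesis .
qed

lemma two_mult_le_square_plus_1: "2 * x \<le> x * x + (1 :: real)"
  using zero_le_power2[of "x - 1"] by (simp add: power2_eq_square algebra_simps)

lemma second_moment_op_divide:
  "second_moment_op p m S (\<lambda>i k. G i k / c) i k = second_moment_op p m S G i k / c"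
  by (auto simp: second_moment_op_def sum_divide_distrib split: nat.splits)

lemma second_moment_op_mono:
  assumes "\<And>j. 0 \<le> m j" and "\<And>j l. 0 \<le> S j l"
    and "\<And>j l. j < p \<Longrightarrow> l < p \<Longrightarrow> F j l \<le> G j l" and "i < p" "k < p"
  shows "second_moment_op p m S F i k \<le> second_moment_op p m S G i k"
  using assms by (auto simp: second_moment_op_def intro!: sum_mono mult_left_mono split: nat.splits)

lemma meeting_limit_cong:
  assumes "\<And>j. 1 \<le> j \<Longrightarrow> j \<le> p \<Longrightarrow> m j = m' j"
  shows "meeting_limit p m x y = meeting_limit p m' x y"
proof -
  have "meeting_weight p m n x y = meeting_weight p m' n x y" for n
    using assms by (induction p m n x y rule: meeting_weight.induct) (auto intro!: sum.cong)
  then show ?thesis by (simp add: meeting_limit_def)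
qed

theorem theorem3p1:
  fixes M :: "'a measure" and N :: "'b measure" and p :: nat
    and A :: "nat \<Rightarrow> 'a \<Rightarrow> real"
    and X :: "int \<Rightarrow> nat \<Rightarrow> 'b \<Rightarrow> real"
  assumes "prob_space M" and "prob_space N"
    and "p \<ge> 1"
    and "\<And>j. j \<ge> 1 \<Longrightarrow> A j \<in> borel_measurable M"
    and "\<And>j. j \<ge> 1 \<Longrightarrow> AE \<omega> in M. 0 \<le> A j \<omega>"
    and "\<And>j. j > p \<Longrightarrow> AE \<omega> in M. A j \<omega> = 0"
    and "\<And>j. 1 \<le> j \<Longrightarrow> j \<le> p \<Longrightarrow> AE \<omega> in M. 0 < A j \<omega>"
    and "iid_copies M A N X"
  shows "((\<Sum>\<^sub>\<infinity>(s, t)\<in>closed_pairs. \<integral>\<^sup>+\<omega>. ennreal (seq_prod X s \<omega> * seq_prod X t \<omega>) \<partial>N) < 1 \<and>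
          (\<Sum>\<^sub>\<infinity>j\<in>{1..}. \<integral>\<^sup>+\<omega>. ennreal (A j \<omega>) \<partial>M) < 1)
     \<longleftrightarrow> ennreal_spectral_radius
           (nn_expectation_mat M (p * p) (p * p)
             (\<lambda>\<omega>. kronecker_prod (companion p (\<lambda>j. A j \<omega>)) (companion p (\<lambda>j. A j \<omega>)))) < 1"
proof -
  interpret M: prob_space M by fact
  note p = \<open>p \<ge> 1\<close>
  have A_meas [measurable]: "A (Suc j) \<in> borel_measurable M" for j using assms(4)[of "Suc j"] by simp
  define mE where "mE = (\<lambda>j. \<integral>\<^sup>+\<omega>. ennreal (A j \<omega>) \<partial>M)"
  define SE where "SE = (\<lambda>j l. \<integral>\<^sup>+\<omega>. ennreal (A j \<omega> * A l \<omega>) \<partial>M)"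
  \<comment> \<open>\<open>enn2real\<close> sends infinity to 0, so \<open>m\<close> and
    \<open>S\<close> represent the moments only once these are known to be finite. Each direction
    therefore establishes \<open>fin\<close> before using them.\<close>
  define m where "m = (\<lambda>j. enn2real (mE j))"
  define S where "S = (\<lambda>j l. enn2real (SE j l))"
  define B where "B = nn_expectation_mat M (p * p) (p * p)
    (\<lambda>\<omega>. kronecker_prod (companion p (\<lambda>j. A j \<omega>)) (companion p (\<lambda>j. A j \<omega>)))"
  have m0: "0 \<le> m j" and S0: "0 \<le> S j l" for j l by (simp_all add: m_def S_def)
  have mE_0: "mE j = 0" if "j > p" for j
  proof -
    have "AE \<omega> in M. ennreal (A j \<omega>) = 0" using assms(6)[OF that] by eventually_elim simp
    then show ?thesis unfolding mE_def by (simp add: nn_integral_cong_AE)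
  qed
  have SE_0: "SE j l = 0" if "j > p \<or> l > p" for j l
  proof -
    have "AE \<omega> in M. A j \<omega> = 0 \<or> A l \<omega> = 0" using assms(6)[of j] assms(6)[of l] that by auto
    then have "AE \<omega> in M. ennreal (A j \<omega> * A l \<omega>) = 0" by eventually_elim auto
    then show ?thesis unfolding SE_def by (simp add: nn_integral_cong_AE)
  qed
  have mE_pos: "0 < mE j" if "1 \<le> j" "j \<le> p" for j
  proof (rule ccontr)
    have [measurable]: "A j \<in> borel_measurable M" using assms(4) that by simp
    assume "\<not> 0 < mE j"
    then have "AE \<omega> in M. ennreal (A j \<omega>) = 0" unfolding mE_def by (simp add: nn_integral_0_iff_AE del: ennreal_eq_zero_iff)
    then have "AE \<omega> in M. False" using assms(7)[OF that] by eventually_elim simp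
    then show False by simp
  qed
  define L where "L = (\<Sum>j=1..p. \<Sum>l=1..p. SE j l * meeting_limit p mE (int j) (int l))"
  have L: "(\<Sum>\<^sub>\<infinity>(s, t)\<in>closed_pairs. \<integral>\<^sup>+\<omega>. ennreal (seq_prod X s \<omega> * seq_prod X t \<omega>) \<partial>N) = L"
  proof -
    have "(\<Sum>\<^sub>\<infinity>(s, t)\<in>closed_pairs. \<integral>\<^sup>+\<omega>. ennreal (seq_prod X s \<omega> * seq_prod X t \<omega>) \<partial>N) =
      (\<Sum>\<^sub>\<infinity>(s, t)\<in>closed_pairs. SE (nat (s ! 1)) (nat (t ! 1)) * (path_weight mE (tl s) * path_weight mE (tl t)))"
      unfolding SE_def mE_def
      using nn_integral_closed_pair[OF assms(2,4,5,8)] by (intro infsum_cong) auto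
    also have "\<dots> = (SUP n. \<Sum>j=1..p. \<Sum>l=1..p. SE j l * meeting_weight p mE n (int j) (int l))"
      by (rule infsum_closed_pairs) (auto simp: mE_0 SE_0)
    also have "\<dots> = L"
      unfolding L_def sum_mult_meeting_limit
      by (intro ennreal_SUP_sum)
        (auto simp: incseq_def intro!: sum_mono mult_left_mono incseqD[OF incseq_meeting_weight])
    finally show ?thesis .
  qed
  have sum_mE: "(\<Sum>\<^sub>\<infinity>j\<in>{1..}. \<integral>\<^sup>+\<omega>. ennreal (A j \<omega>) \<partial>M) = (\<Sum>j<p. mE (Suc j))"
  proof -
    have "(\<Sum>\<^sub>\<infinity>j\<in>{1..}. mE j) = (\<Sum>\<^sub>\<infinity>j\<in>{1..p}. mE j)"
      by (intro infsum_cong_neutral) (auto simp: mE_0)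
    then show ?thesis by (simp add: mE_def sum.atLeast1_atMost_eq)
  qed
  have B_entry: "B $$ (i * p + k, j * p + l) = second_moment_entry mE SE i k j l"
    if "i < p" "k < p" "j < p" "l < p" for i k j l
    unfolding B_def mE_def SE_def by (rule nn_expectation_kronecker_companion[OF assms(1) that])
  have B_dim: "dim_row B = p * p" "dim_col B = p * p" by (simp_all add: B_def nn_expectation_mat_def)
  have radius: "ennreal_spectral_radius B < 1 \<longleftrightarrow>
      (\<exists>G. \<forall>i<p. \<forall>k<p. 0 < G i k \<and> second_moment_op p m S G i k < G i k)"
    if fin: "(\<forall>j<p. mE (Suc j) \<noteq> \<infinity>) \<and> (\<forall>j<p. \<forall>l<p. SE (Suc j) (Suc l) \<noteq> \<infinity>)"
  proof -
    have "B $$ (a, b) \<noteq> \<infinity>" if ab: "a < p * p" "b < p * p" for a b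
    proof -
      have *: "a div p < p" "b div p < p" "a mod p < p" "b mod p < p"
        using ab p by (auto simp: less_mult_imp_div_less)
      have "B $$ (a div p * p + a mod p, b div p * p + b mod p) \<noteq> \<infinity>"
        unfolding B_entry[OF *(1,3,2,4)] second_moment_entry_def
        using fin * by (auto split: nat.splits)
      then show ?thesis by simp
    qed
    then have "ennreal_spectral_radius B < 1 \<longleftrightarrow>
        spectral_radius (map_mat complex_of_real (map_mat enn2real B)) < 1"
      unfolding ennreal_spectral_radius_def B_dim
      by (auto simp: ennreal_less_one_iff comp_def intro!: arg_cong[where f = "\<lambda>x. spectral_radius x < 1"])
    also have "\<dots> \<longleftrightarrow> (\<exists>G. \<forall>i<p. \<forall>k<p. 0 < G i k \<and> second_moment_op p m S G i k < G i k)"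
    proof (rule spectral_radius_second_moment[OF p _ _ m0 S0])
      show "map_mat enn2real B \<in> carrier_mat (p * p) (p * p)" using B_dim by auto
      show "map_mat enn2real B $$ (i * p + k, j * p + l) = second_moment_entry m S i k j l"
        if "i < p" "k < p" "j < p" "l < p" for i k j l
        using B_entry[OF that] index_less_square[OF that(1,2)] index_less_square[OF that(3,4)] B_dim
        by (auto simp: second_moment_entry_def m_def S_def split: nat.splits)
    qed
    finally show ?thesis .
  qed
  have real_eqs: "\<And>j. j < p \<Longrightarrow> mE (Suc j) = ennreal (m (Suc j))"
      "\<And>j l. j < p \<Longrightarrow> l < p \<Longrightarrow> SE (Suc j) (Suc l) = ennreal (S (Suc j) (Suc l))"
      "\<And>x y. meeting_limit p mE x y = meeting_limit p (\<lambda>j. ennreal (m j)) x y"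
    and L_eq: "L = (\<Sum>j=1..p. \<Sum>l=1..p. ennreal (S j l) * meeting_limit p mE (int j) (int l))"
    if fin: "(\<forall>j<p. mE (Suc j) \<noteq> \<infinity>) \<and> (\<forall>j<p. \<forall>l<p. SE (Suc j) (Suc l) \<noteq> \<infinity>)"
  proof -
    show m_eq: "\<And>j. j < p \<Longrightarrow> mE (Suc j) = ennreal (m (Suc j))"
      using fin by (simp add: m_def less_top)
    show S_eq: "\<And>j l. j < p \<Longrightarrow> l < p \<Longrightarrow> SE (Suc j) (Suc l) = ennreal (S (Suc j) (Suc l))"
      using fin by (simp add: S_def less_top)
    show "meeting_limit p mE x y = meeting_limit p (\<lambda>j. ennreal (m j)) x y" for x y
    proof (rule meeting_limit_cong)
      fix j assume "1 \<le> j" "j \<le> p"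
      then show "mE j = ennreal (m j)" using m_eq[of "j - 1"] by simp
    qed
    show "L = (\<Sum>j=1..p. \<Sum>l=1..p. ennreal (S j l) * meeting_limit p mE (int j) (int l))"
      unfolding L_def by (simp add: sum.atLeast1_atMost_eq S_eq)
  qed
  \<comment> \<open>This integrates 2 Y <= Y^2 + 1 for a partial sum Y of the sequence. It is stated
    in \<open>ennreal\<close> because the singletons \<open>J\<close> are used to derive finiteness;
    the full range gives the bound on the means.\<close>
  have var: "2 * (\<Sum>j\<in>J. mE (Suc j)) \<le> (\<Sum>j\<in>J. \<Sum>l\<in>J. SE (Suc j) (Suc l)) + 1" if J: "finite J" for J
  proof -
    have nonneg: "AE \<omega> in M. \<forall>j\<in>J. 0 \<le> A (Suc j) \<omega>"
      using J assms(5) by (intro AE_finite_allI) auto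
    have "2 * (\<Sum>j\<in>J. mE (Suc j)) = (\<integral>\<^sup>+\<omega>. 2 * (\<Sum>j\<in>J. ennreal (A (Suc j) \<omega>)) \<partial>M)"
      unfolding mE_def by (simp add: nn_integral_cmult nn_integral_sum)
    also have "\<dots> \<le> (\<integral>\<^sup>+\<omega>. (\<Sum>j\<in>J. \<Sum>l\<in>J. ennreal (A (Suc j) \<omega> * A (Suc l) \<omega>)) + 1 \<partial>M)"
    proof (rule nn_integral_mono_AE)
      show "AE \<omega> in M. 2 * (\<Sum>j\<in>J. ennreal (A (Suc j) \<omega>)) \<le>
          (\<Sum>j\<in>J. \<Sum>l\<in>J. ennreal (A (Suc j) \<omega> * A (Suc l) \<omega>)) + 1"
        using nonneg
      proof eventually_elim
        case (elim \<omega>)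
        define Y where "Y = (\<Sum>j\<in>J. A (Suc j) \<omega>)"
        have Y: "0 \<le> Y" using elim by (auto simp: Y_def intro: sum_nonneg)
        have "2 * (\<Sum>j\<in>J. ennreal (A (Suc j) \<omega>)) = ennreal (2 * Y)"
          using elim Y by (simp add: Y_def ennreal_mult)
        also have "\<dots> \<le> ennreal (Y * Y + 1)"
          by (rule ennreal_leI[OF two_mult_le_square_plus_1])
        also have "\<dots> = (\<Sum>j\<in>J. \<Sum>l\<in>J. ennreal (A (Suc j) \<omega> * A (Suc l) \<omega>)) + 1"
          using elim by (simp add: Y_def sum_product sum_nonneg)
        finally show ?case .
      qed
    qed
    also have "\<dots> = (\<Sum>j\<in>J. \<Sum>l\<in>J. SE (Suc j) (Suc l)) + 1"
      unfolding SE_def by (simp add: nn_integral_add nn_integral_sum M.emeasure_space_1)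
    finally show ?thesis .
  qed
  show ?thesis
    unfolding L sum_mE B_def[symmetric]
  proof
    assume less: "L < 1 \<and> (\<Sum>j<p. mE (Suc j)) < 1"
    \<comment> \<open>In \<open>L\<close> each second moment is multiplied by a positive meeting
      weight, so an infinite one would make \<open>L\<close> infinite.\<close>
    have SE_fin: "SE (Suc j) (Suc l) \<noteq> \<infinity>" if jl: "j < p" "l < p" for j l
    proof
      assume top: "SE (Suc j) (Suc l) = \<infinity>"
      let ?f = "\<lambda>j l. SE j l * meeting_limit p mE (int j) (int l)"
      have "0 < meeting_limit p mE (int (Suc j)) (int (Suc l))"
        using jl by (intro meeting_limit_pos mE_pos) auto
      then have "\<infinity> = ?f (Suc j) (Suc l)"
        using top by (simp add: ennreal_top_mult)
      also have "\<dots> \<le> (\<Sum>l=1..p. ?f (Suc j) l)"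
        using jl by (intro member_le_sum) auto
      also have "\<dots> \<le> L"
        unfolding L_def using jl by (intro member_le_sum) auto
      finally show False using less by (simp add: top_unique)
    qed
    have mE_fin: "mE (Suc j) \<noteq> \<infinity>" if "j < p" for j
    proof -
      have "mE (Suc j) \<le> (\<Sum>j<p. mE (Suc j))" using that by (intro member_le_sum) auto
      then have "mE (Suc j) < 1" using less by (auto intro: le_less_trans)
      then show ?thesis by auto
    qed
    have fin: "(\<forall>j<p. mE (Suc j) \<noteq> \<infinity>) \<and> (\<forall>j<p. \<forall>l<p. SE (Suc j) (Suc l) \<noteq> \<infinity>)"
      using mE_fin SE_fin by blast
    note eqs = real_eqs[OF fin]
    have "(\<Sum>j<p. m (Suc j)) < 1"
      using less by (simp add: eqs m0 ennreal_less_one_iff)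
    moreover from this obtain H where H: "\<And>i k. 1 \<le> H i k" "\<And>i k. H i k < H (Suc i) (Suc k)"
        "\<And>k. k < p \<Longrightarrow> (\<Sum>j<p. m (Suc j) * H j k) < H 0 (Suc k)"
        "\<And>i. i < p \<Longrightarrow> (\<Sum>l<p. m (Suc l) * H i l) < H (Suc i) (0 :: nat)"
      using linear_supersolution[of m p, OF m0 _ p] by blast
    moreover define F where "F = (\<lambda>i k. enn2real (meeting_limit p mE (int i) (int k)))"
    moreover have F: "meeting_limit p mE (int i) (int k) = ennreal (F i k)" if "i < p" "k < p" for i k
    proof -
      \<comment> \<open>\<open>H\<close> is a supersolution away from (0, 0) with
        \<open>H 0 0\<close> at least 1, so it is a finite majorant of the meeting weights and
        \<open>F\<close> represents them faithfully.\<close>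
      have "meeting_limit p (\<lambda>j. ennreal (m j)) (int i) (int k) \<le> ennreal (H i k)"
        using H p m0 that order.trans[OF zero_le_one H(1)]
        by (intro meeting_limit_0_le[where S = S and m = m]) (auto simp: second_moment_op_def less_imp_le split: nat.splits)
      then have "meeting_limit p mE (int i) (int k) < \<top>"
        unfolding eqs(3) by (rule le_less_trans) simp
      then show ?thesis by (simp add: F_def)
    qed
    moreover have "second_moment_op p m S F i k \<le> F i k" if "i < p" "k < p" "(i, k) \<noteq> (0, 0)" for i k
      using F by (intro meeting_limit_supersolution that m0) (auto simp: eqs(3) F_def)
    moreover have "second_moment_op p m S F 0 0 < 1"
    proof -
      have "L = ennreal (second_moment_op p m S F 0 0)"
        unfolding L_eq[OF fin] by (rule sum_mult_meeting_limit_0_0[OF S0 _ F]) (simp_all add: F_def)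
      then show ?thesis using less by (simp add: ennreal_less_one_iff)
    qed
    ultimately show "ennreal_spectral_radius B < 1"
      unfolding radius[OF fin]
      by (intro strict_supersolution_exists[where F = F] m0 S0 p) (auto simp: F_def)
  next
    assume less: "ennreal_spectral_radius B < 1"
    have B_fin: "B $$ (a, b) \<noteq> \<infinity>" if "a < p * p" "b < p * p" for a b
      using less that by (auto simp: ennreal_spectral_radius_def B_dim split: if_splits)
    have SE_fin: "SE (Suc j) (Suc l) \<noteq> \<infinity>" if jl: "j < p" "l < p" for j l
      using B_entry[of 0 0 j l] B_fin[OF index_less_square[of 0 p 0] index_less_square[OF jl]] jl p
      by (simp add: second_moment_entry_def)
    \<comment> \<open>For \<open>p\<close> = 1 the mean is not an entry of \<open>B\<close>, so its
      finiteness is obtained from that of the second moment.\<close>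
    have mE_fin: "mE (Suc j) \<noteq> \<infinity>" if "j < p" for j
      using var[of "{j}"] SE_fin[OF that that]
      by (auto simp: top_unique ennreal_mult_eq_top_iff)
    have fin: "(\<forall>j<p. mE (Suc j) \<noteq> \<infinity>) \<and> (\<forall>j<p. \<forall>l<p. SE (Suc j) (Suc l) \<noteq> \<infinity>)"
      using mE_fin SE_fin by blast
    note eqs = real_eqs[OF fin]
    obtain G where G: "\<And>i k. i < p \<Longrightarrow> k < p \<Longrightarrow> 0 < G i k"
      "\<And>i k. i < p \<Longrightarrow> k < p \<Longrightarrow> second_moment_op p m S G i k < G i k"
      using less unfolding radius[OF fin] by blast
    have "ennreal (2 * (\<Sum>j<p. m (Suc j))) \<le> ennreal ((\<Sum>j<p. \<Sum>l<p. S (Suc j) (Suc l)) + 1)"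
      using var[of "{..<p}"] by (simp add: eqs m0 S0 ennreal_mult sum_nonneg)
    then have "2 * (\<Sum>j<p. m (Suc j)) \<le> (\<Sum>j<p. \<Sum>l<p. S (Suc j) (Suc l)) + 1"
      by (subst (asm) ennreal_le_iff) (auto intro!: add_nonneg_nonneg sum_nonneg S0)
    from strict_supersolution_imp_mean_less_1[of m S p G, OF m0 S0 p this G]
    have mean: "(\<Sum>j<p. mE (Suc j)) < 1"
      by (simp add: eqs m0 ennreal_less_one_iff)
    \<comment> \<open>Dividing by \<open>G 0 0\<close> normalises the supersolution to 1 at (0, 0),
      the value of the meeting weight there.\<close>
    define c where "c = G 0 0"
    have c: "0 < c" using G(1) p by (simp add: c_def)
    define F where "F = (\<lambda>i k. enn2real (meeting_limit p mE (int i) (int k)))"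
    have le: "meeting_limit p mE (int i) (int k) \<le> ennreal (G i k / c)" if "i < p" "k < p" for i k
      unfolding eqs(3)
    proof (rule meeting_limit_0_le[where S = S and m = m, OF p m0])
      show "1 \<le> G 0 0 / c" using c by (simp add: c_def)
      show "0 \<le> G i k / c" if "i < p" "k < p" for i k using G(1)[OF that] c by simp
      show "second_moment_op p m S (\<lambda>i k. G i k / c) i k \<le> G i k / c" if "i < p" "k < p" for i k
        unfolding second_moment_op_divide using G(2)[OF that] c by (simp add: divide_right_mono)
    qed fact+
    have F: "meeting_limit p mE (int i) (int k) = ennreal (F i k)" if "i < p" "k < p" for i k
      using le_less_trans[OF le[OF that] ennreal_less_top] by (simp add: F_def)
    have "L = ennreal (second_moment_op p m S F 0 0)"
      unfolding L_eq[OF fin] by (rule sum_mult_meeting_limit_0_0[OF S0 _ F]) (simp_all add: F_def)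
    also have "\<dots> < 1"
    proof -
      have "F i k \<le> G i k / c" if "i < p" "k < p" for i k
        using le[OF that] G(1)[OF that] c unfolding F[OF that] by simp
      \<comment> \<open>Strictness of \<open>G\<close> at (0, 0) is what makes the return weight
        less than 1: it is at most (R G)(0, 0) / G(0, 0).\<close>
      then have "second_moment_op p m S F 0 0 \<le> second_moment_op p m S (\<lambda>i k. G i k / c) 0 0"
        using p by (intro second_moment_op_mono m0 S0) auto
      also have "\<dots> < 1"
        unfolding second_moment_op_divide using G(2)[of 0 0] p c by (simp add: c_def)
      finally show ?thesis by (simp add: ennreal_less_one_iff)
    qed
    finally show "L < 1 \<and> (\<Sum>j<p. mE (Suc j)) < 1" using mean by simp
  qed
qed

end
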